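(* Let $\Gamma$ be a discrete cocompact subgroup of $\mathrm{PSU}(1,1)$ and let $\mathfrak{g}$ be the space of Killing vector fields on $\mathbb{D}$. Let $\varphi$ be a smooth function on $\mathbb{D}$ such that $0\le\varphi\le1$; for each $z\in\mathbb{D}$ there are a neighborhood $U$ of $z$ and a finite subset $S\subset\Gamma$ with $\varphi=0$ on $\gamma(U)$ for every $\gamma\in\Gamma-S$; and $\sum_{\gamma\in\Gamma}\varphi(\gamma(z))=1$ on $\mathbb{D}$. Let $c$ be a $1$-cocycle representing a class $[c]\in H^1(\Gamma;\mathfrak{g})$ and set $$\psi(z)=-\sum_{\gamma\in\Gamma}\varphi(\gamma(z))\,c_\gamma(z),\qquad z\in\mathbb{D}.$$ Then the vector field $\psi$ admits a unique $L^2$-extension to the closed unit disk $\overline{\mathbb{D}}$, and the restriction $\psi^\sharp$ of this extension to the boundary circle $\mathbb{S}^1$ is tangential.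
   Context: $\mathrm{PSU}(1,1)$ acts on $\mathbb{D}=\{|z|<1\}$ by $\gamma(z)=\frac{az+b}{\bar bz+\bar a}$, $|a|^2-|b|^2=1$; it is the group of orientation preserving isometries of the hyperbolic metric, with Lie algebra $\mathfrak{g}$. Vector fields are identified with $\mathbb{C}$-valued functions. Cohomology: $\Gamma$ acts on vector fields on $\mathbb{D}$ by $(\gamma^*F)(z)=F(\gamma(z))\gamma'(z)^{-1}$. A $1$-cocycle is a map $c:\Gamma\to\mathfrak{g}$ with $c_{\gamma_1\circ\gamma_2}=\gamma_2^*c_{\gamma_1}+c_{\gamma_2}$; $H^1(\Gamma;\mathfrak{g})$ is cocycles modulo coboundaries $\gamma\mapsto\gamma^*m-m$, $m\in\mathfrak{g}$. $L^2$-extension: a continuous vector field $X$ on $\mathbb{D}$ has an $L^2$-extension to $\overline{\mathbb{D}}$ if the vector fields $X_\epsilon(z)=X((1-\epsilon)z)$ on $\mathbb{S}^1$ converge as $\epsilon\to0$ in the Hilbert space of $L^2$-vector fields ($\mathbb{C}$-valued functions) on $\mathbb{S}^1$; the limit is the restriction of the extension to $\mathbb{S}^1$. An $L^2$-vector field on $\mathbb{S}^1$ is tangential if it is of the form $z\mapsto f(z)\,iz$ with $f$ real-valued. *)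

theory Defs
  imports "HOL-Analysis.Analysis" "HOL-Algebra.Coset"
begin

abbreviation unit_disk :: "complex set" where
  "unit_disk \<equiv> ball 0 1"

definition SU11 :: "(complex \<times> complex) set" where
  "SU11 = {(a, b). (cmod a)\<^sup>2 - (cmod b)\<^sup>2 = 1}"

text \<open>Transformations of the disk are extensional functions (undefined outside the disk), so that
  two pairs in \<^term>\<open>SU11\<close> give the same transformation iff they agree up to sign.\<close>

definition disk_moebius :: "complex \<times> complex \<Rightarrow> complex \<Rightarrow> complex" where
  "disk_moebius = (\<lambda>(a, b). \<lambda>z\<in>unit_disk. (a * z + b) / (cnj b * z + cnj a))"

definition PSU11 :: "(complex \<Rightarrow> complex) monoid" where
  "PSU11 = \<lparr>carrier = disk_moebius ` SU11, mult = compose unit_disk, one = (\<lambda>z\<in>unit_disk. z)\<rparr>"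

definition quot_topology :: "'a topology \<Rightarrow> ('a \<Rightarrow> 'b) \<Rightarrow> 'b topology" where
  "quot_topology X f =
     topology (\<lambda>U. U \<subseteq> f ` topspace X \<and> openin X {x \<in> topspace X. f x \<in> U})"

lemma openin_quot_topology:
  "openin (quot_topology X f) U \<longleftrightarrow> U \<subseteq> f ` topspace X \<and> openin X {x \<in> topspace X. f x \<in> U}"
proof -
  have "istopology (\<lambda>U. U \<subseteq> f ` topspace X \<and> openin X {x \<in> topspace X. f x \<in> U})"
    unfolding istopology_def
  proof (intro conjI allI impI; (elim conjE)?)
    fix S T
    assume "openin X {x \<in> topspace X. f x \<in> S}" "openin X {x \<in> topspace X. f x \<in> T}"
    then have "openin X ({x \<in> topspace X. f x \<in> S} \<inter> {x \<in> topspace X. f x \<in> T})"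
      by (rule openin_Int)
    moreover have "{x \<in> topspace X. f x \<in> S} \<inter> {x \<in> topspace X. f x \<in> T}
        = {x \<in> topspace X. f x \<in> S \<inter> T}" by auto
    ultimately show "openin X {x \<in> topspace X. f x \<in> S \<inter> T}" by simp
  next
    fix \<K> assume *: "\<forall>K\<in>\<K>. K \<subseteq> f ` topspace X \<and> openin X {x \<in> topspace X. f x \<in> K}"
    then have "openin X (\<Union>K\<in>\<K>. {x \<in> topspace X. f x \<in> K})"
      by (intro openin_Union) auto
    moreover have "(\<Union>K\<in>\<K>. {x \<in> topspace X. f x \<in> K}) = {x \<in> topspace X. f x \<in> \<Union>\<K>}"
      by auto
    ultimately show "openin X {x \<in> topspace X. f x \<in> \<Union>\<K>}" by simp
    show "\<Union>\<K> \<subseteq> f ` topspace X" using * by blast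
  qed auto
  then show ?thesis
    by (simp add: quot_topology_def topology_inverse')
qed

lemma topspace_quot_topology: "topspace (quot_topology X f) = f ` topspace X"
proof
  show "topspace (quot_topology X f) \<subseteq> f ` topspace X"
    by (metis openin_quot_topology openin_topspace)
  have "{x \<in> topspace X. f x \<in> f ` topspace X} = topspace X" by auto
  then show "f ` topspace X \<subseteq> topspace (quot_topology X f)"
    by (intro openin_subset) (simp add: openin_quot_topology)
qed

lemma quotient_map_quot_topology: "quotient_map X (quot_topology X f) f"
  unfolding quotient_map_def by (simp add: topspace_quot_topology openin_quot_topology)

definition PSU11_topology :: "(complex \<Rightarrow> complex) topology" where
  "PSU11_topology = quot_topology (top_of_set SU11) disk_moebius"

definition discrete_in_PSU11 :: "(complex \<Rightarrow> complex) set \<Rightarrow> bool" where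
  "discrete_in_PSU11 \<Gamma> \<longleftrightarrow> subtopology PSU11_topology \<Gamma> = discrete_topology \<Gamma>"

definition cocompact_in_PSU11 :: "(complex \<Rightarrow> complex) set \<Rightarrow> bool" where
  "cocompact_in_PSU11 \<Gamma> \<longleftrightarrow>
     compact_space (quot_topology PSU11_topology (\<lambda>g. \<Gamma> #>\<^bsub>PSU11\<^esub> g))"

lemma disk_moebius_in_disk:
  assumes "(a, b) \<in> SU11" and "z \<in> unit_disk"
  shows "cnj b * z + cnj a \<noteq> 0" and "disk_moebius (a, b) z \<in> unit_disk"
proof -
  have z: "cmod z < 1" using assms by simp
  have ab: "(cmod a)\<^sup>2 = (cmod b)\<^sup>2 + 1" using assms by (simp add: SU11_def)
  have eq: "(cmod (cnj b * z + cnj a))\<^sup>2 - (cmod (a * z + b))\<^sup>2 = 1 - (cmod z)\<^sup>2"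
  proof -
    have "complex_of_real ((cmod (cnj b * z + cnj a))\<^sup>2 - (cmod (a * z + b))\<^sup>2)
        = complex_of_real (((cmod a)\<^sup>2 - (cmod b)\<^sup>2) * (1 - (cmod z)\<^sup>2))"
      by (simp add: complex_norm_square[unfolded of_real_power] algebra_simps)
    then show ?thesis using ab by (simp only: of_real_eq_iff) simp
  qed
  have "(cmod z)\<^sup>2 < 1" using z by (simp add: power_less_one_iff)
  with eq have lt: "(cmod (a * z + b))\<^sup>2 < (cmod (cnj b * z + cnj a))\<^sup>2" by linarith
  then show nz: "cnj b * z + cnj a \<noteq> 0" by auto
  have "cmod (a * z + b) < cmod (cnj b * z + cnj a)"
    using lt by (rule power_less_imp_less_base) simp
  then show "disk_moebius (a, b) z \<in> unit_disk"
    using assms(2) nz by (simp add: disk_moebius_def norm_divide)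
qed

lemma SU11_mult:
  assumes "(a, b) \<in> SU11" and "(c, d) \<in> SU11"
  shows "(a * c + b * cnj d, a * d + b * cnj c) \<in> SU11"
proof -
  have "complex_of_real ((cmod (a * c + b * cnj d))\<^sup>2 - (cmod (a * d + b * cnj c))\<^sup>2)
      = complex_of_real (((cmod a)\<^sup>2 - (cmod b)\<^sup>2) * ((cmod c)\<^sup>2 - (cmod d)\<^sup>2))"
    by (simp add: complex_norm_square[unfolded of_real_power] algebra_simps)
  then show ?thesis using assms by (simp only: of_real_eq_iff) (simp add: SU11_def)
qed

lemma compose_disk_moebius:
  assumes "(a, b) \<in> SU11" and "(c, d) \<in> SU11"
  shows "compose unit_disk (disk_moebius (a, b)) (disk_moebius (c, d))
    = disk_moebius (a * c + b * cnj d, a * d + b * cnj c)"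
proof
  fix z
  show "compose unit_disk (disk_moebius (a, b)) (disk_moebius (c, d)) z
    = disk_moebius (a * c + b * cnj d, a * d + b * cnj c) z"
  proof (cases "z \<in> unit_disk")
    case True
    have n1: "cnj d * z + cnj c \<noteq> 0" and w: "disk_moebius (c, d) z \<in> unit_disk"
      using disk_moebius_in_disk[OF assms(2) True] by auto
    have w_eq: "disk_moebius (c, d) z = (c * z + d) / (cnj d * z + cnj c)"
      using True by (simp add: disk_moebius_def)
    have *: "disk_moebius (a, b) w = (a * w + b) / (cnj b * w + cnj a)" if "w \<in> unit_disk" for w
      using that by (simp add: disk_moebius_def)
    have alg: "(a * (p / q) + b) / (b' * (p / q) + a') = (a * p + b * q) / (b' * p + a' * q)"
      if "q \<noteq> 0" for p q a' b' :: complex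
    proof -
      have "a * (p / q) + b = (a * p + b * q) / q" "b' * (p / q) + a' = (b' * p + a' * q) / q"
        using that by (simp_all add: field_simps)
      then show ?thesis using that by simp
    qed
    have "compose unit_disk (disk_moebius (a, b)) (disk_moebius (c, d)) z
        = disk_moebius (a, b) (disk_moebius (c, d) z)"
      using True by (simp add: compose_def)
    also have "\<dots> = (a * (c * z + d) + b * (cnj d * z + cnj c))
        / (cnj b * (c * z + d) + cnj a * (cnj d * z + cnj c))"
      unfolding *[OF w] unfolding w_eq by (rule alg[OF n1])
    also have "\<dots> = disk_moebius (a * c + b * cnj d, a * d + b * cnj c) z"
      using True by (simp add: disk_moebius_def algebra_simps)
    finally show ?thesis .
  qed (simp add: compose_def disk_moebius_def)
qed

lemma group_PSU11: "group PSU11"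
proof (rule groupI)
  fix f g assume "f \<in> carrier PSU11" "g \<in> carrier PSU11"
  then show "f \<otimes>\<^bsub>PSU11\<^esub> g \<in> carrier PSU11"
    by (auto simp: PSU11_def compose_disk_moebius SU11_mult)
next
  have "(\<lambda>z\<in>unit_disk. z) = disk_moebius (1, 0)" by (auto simp: disk_moebius_def)
  then show "\<one>\<^bsub>PSU11\<^esub> \<in> carrier PSU11" by (auto simp: PSU11_def SU11_def)
next
  fix f g h assume "f \<in> carrier PSU11" "g \<in> carrier PSU11" "h \<in> carrier PSU11"
  then have "h \<in> unit_disk \<rightarrow> unit_disk"
    using disk_moebius_in_disk by (fastforce simp: PSU11_def)
  then show "f \<otimes>\<^bsub>PSU11\<^esub> g \<otimes>\<^bsub>PSU11\<^esub> h = f \<otimes>\<^bsub>PSU11\<^esub> (g \<otimes>\<^bsub>PSU11\<^esub> h)"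
    using compose_assoc[of h unit_disk unit_disk f g] by (simp add: PSU11_def)
next
  fix f assume "f \<in> carrier PSU11"
  then obtain a b where ab: "(a, b) \<in> SU11" and f: "f = disk_moebius (a, b)"
    by (auto simp: PSU11_def)
  have id: "(\<lambda>z\<in>unit_disk. z) = disk_moebius (1, 0)" by (auto simp: disk_moebius_def)
  show "\<one>\<^bsub>PSU11\<^esub> \<otimes>\<^bsub>PSU11\<^esub> f = f"
    using compose_disk_moebius[of 1 0 a b] ab id f by (simp add: PSU11_def SU11_def)
  have inv: "(cnj a, - b) \<in> SU11" using ab by (simp add: SU11_def)
  have "complex_of_real ((cmod a)\<^sup>2 - (cmod b)\<^sup>2) = 1" using ab by (simp add: SU11_def)
  then have "cnj a * a - b * cnj b = 1"
    by (simp add: complex_norm_square[unfolded of_real_power] mult.commute)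
  then have "disk_moebius (cnj a, - b) \<otimes>\<^bsub>PSU11\<^esub> f = \<one>\<^bsub>PSU11\<^esub>"
    using compose_disk_moebius[OF inv ab] id f by (simp add: PSU11_def mult.commute)
  then show "\<exists>g\<in>carrier PSU11. g \<otimes>\<^bsub>PSU11\<^esub> f = \<one>\<^bsub>PSU11\<^esub>"
    using inv by (auto simp: PSU11_def)
qed

text \<open>Smoothness is over the reals: \<^term>\<open>frechet_derivative f (at x)\<close> is the real-linear total
  derivative, and \<^term>\<open>Ck_on S f n\<close> says that all iterated directional derivatives up to order
  \<^term>\<open>n\<close> exist and are continuous. It is meant for open \<^term>\<open>S\<close>.\<close>

primrec Ck_on :: "'a::real_normed_vector set \<Rightarrow> ('a \<Rightarrow> 'b::real_normed_vector) \<Rightarrow> nat \<Rightarrow> bool" where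
  "Ck_on S f 0 \<longleftrightarrow> continuous_on S f"
| "Ck_on S f (Suc n) \<longleftrightarrow>
     (\<forall>x\<in>S. f differentiable (at x)) \<and> (\<forall>v. Ck_on S (\<lambda>x. frechet_derivative f (at x) v) n)"

definition smooth_on :: "'a::real_normed_vector set \<Rightarrow> ('a \<Rightarrow> 'b::real_normed_vector) \<Rightarrow> bool" where
  "smooth_on S f \<longleftrightarrow> (\<forall>n. Ck_on S f n)"

text \<open>The metric tensor \<open>4 |dz|\<^sup>2 / (1 - |z|\<^sup>2)\<^sup>2\<close> of curvature -1.\<close>

definition hyp_metric :: "complex \<Rightarrow> complex \<Rightarrow> complex \<Rightarrow> real" where
  "hyp_metric z v w = 4 / (1 - (cmod z)\<^sup>2)\<^sup>2 * (v \<bullet> w)"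

text \<open>The Lie derivative of the metric along \<^term>\<open>X\<close>, evaluated at \<^term>\<open>z\<close> on the tangent
  vectors \<^term>\<open>v\<close> and \<^term>\<open>w\<close> (extended to constant vector fields).\<close>

definition lie_hyp_metric :: "(complex \<Rightarrow> complex) \<Rightarrow> complex \<Rightarrow> complex \<Rightarrow> complex \<Rightarrow> real" where
  "lie_hyp_metric X z v w =
     frechet_derivative (\<lambda>x. hyp_metric x v w) (at z) (X z)
     + hyp_metric z (frechet_derivative X (at z) v) w
     + hyp_metric z v (frechet_derivative X (at z) w)"

text \<open>Vector fields on the disk are functions on \<^typ>\<open>complex\<close> whose values outside the disk are
  irrelevant; accordingly equations between them are only required on the disk.\<close>

definition killing_fields :: "(complex \<Rightarrow> complex) set" where
  "killing_fields =
     {X. smooth_on unit_disk X \<and> (\<forall>z\<in>unit_disk. \<forall>v w. lie_hyp_metric X z v w = 0)}"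

definition pullback :: "(complex \<Rightarrow> complex) \<Rightarrow> (complex \<Rightarrow> complex) \<Rightarrow> complex \<Rightarrow> complex" where
  "pullback \<gamma> F z = F (\<gamma> z) * inverse (deriv \<gamma> z)"

definition cocycle ::
  "(complex \<Rightarrow> complex) set \<Rightarrow> ((complex \<Rightarrow> complex) \<Rightarrow> complex \<Rightarrow> complex) \<Rightarrow> bool" where
  "cocycle \<Gamma> c \<longleftrightarrow>
     (\<forall>\<gamma>\<in>\<Gamma>. c \<gamma> \<in> killing_fields) \<and>
     (\<forall>\<gamma>\<^sub>1\<in>\<Gamma>. \<forall>\<gamma>\<^sub>2\<in>\<Gamma>. \<forall>z\<in>unit_disk.
        c (\<gamma>\<^sub>1 \<otimes>\<^bsub>PSU11\<^esub> \<gamma>\<^sub>2) z = pullback \<gamma>\<^sub>2 (c \<gamma>\<^sub>1) z + c \<gamma>\<^sub>2 z)"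

text \<open>Arc length on the unit circle, of total mass \<open>2\<pi>\<close>.\<close>

definition circle_measure :: "complex measure" where
  "circle_measure =
     distr (restrict_space lborel {0..2 * pi}) (restrict_space borel (sphere 0 1)) cis"

lemma measurable_cis_circle:
  "cis \<in> restrict_space lborel {0..2 * pi} \<rightarrow>\<^sub>M restrict_space borel (sphere 0 1)"
proof (rule measurable_restrict_space2)
  have "cis \<in> borel_measurable lborel"
    using borel_measurable_continuous_onI[of cis] by (simp add: continuous_on_cis)
  then show "cis \<in> borel_measurable (restrict_space lborel {0..2 * pi})"
    by (rule measurable_restrict_space1)
qed (auto simp: norm_cis)

lemma emeasure_circle_measure: "emeasure circle_measure (sphere 0 1) = ennreal (2 * pi)"
proof -
  have "sphere 0 1 \<in> sets (restrict_space (borel :: complex measure) (sphere 0 1))"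
    by (simp add: sets_restrict_space_iff)
  moreover have "cis -` sphere 0 1 = UNIV" by (auto simp: norm_cis)
  ultimately show ?thesis
    unfolding circle_measure_def
    by (simp add: emeasure_distr[OF measurable_cis_circle] emeasure_restrict_space
        space_restrict_space)
qed

definition L2_circle :: "(complex \<Rightarrow> complex) \<Rightarrow> bool" where
  "L2_circle F \<longleftrightarrow>
     F \<in> borel_measurable circle_measure \<and> integrable circle_measure (\<lambda>z. (cmod (F z))\<^sup>2)"

definition L2_circle_tendsto ::
  "('i \<Rightarrow> complex \<Rightarrow> complex) \<Rightarrow> (complex \<Rightarrow> complex) \<Rightarrow> 'i filter \<Rightarrow> bool" where
  "L2_circle_tendsto F G A \<longleftrightarrow>
     (\<forall>\<^sub>F i in A. L2_circle (F i)) \<and> L2_circle G \<and>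
     ((\<lambda>i. sqrt (LINT z|circle_measure. (cmod (F i z - G z))\<^sup>2)) \<longlongrightarrow> 0) A"

text \<open>\<^term>\<open>Z\<close> is an extension of \<^term>\<open>X\<close> to the closed disk: it agrees with \<^term>\<open>X\<close> on the open
  disk, and on the circle it represents the \<open>L\<^sup>2\<close>-limit.\<close>

definition L2_extension :: "(complex \<Rightarrow> complex) \<Rightarrow> (complex \<Rightarrow> complex) \<Rightarrow> bool" where
  "L2_extension X Z \<longleftrightarrow>
     continuous_on unit_disk X \<and> (\<forall>z\<in>unit_disk. Z z = X z) \<and>
     L2_circle_tendsto (\<lambda>\<epsilon> z. X (of_real (1 - \<epsilon>) * z)) Z (at_right (0::real))"

text \<open>Identity of extensions: on the circle these are elements of an \<open>L\<^sup>2\<close>-space.\<close>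

definition L2_extension_eq :: "(complex \<Rightarrow> complex) \<Rightarrow> (complex \<Rightarrow> complex) \<Rightarrow> bool" where
  "L2_extension_eq Z Z' \<longleftrightarrow>
     (\<forall>z\<in>unit_disk. Z z = Z' z) \<and> (AE z in circle_measure. Z z = Z' z)"

definition tangential :: "(complex \<Rightarrow> complex) \<Rightarrow> bool" where
  "tangential Y \<longleftrightarrow>
     (\<exists>f :: complex \<Rightarrow> real. AE z in circle_measure. Y z = of_real (f z) * (\<i> * z))"

end

theory Submission
  imports Defs "HOL-Complex_Analysis.Conformal_Mappings" "HOL-Real_Asymp.Real_Asymp"
begin

text \<open>The averaged cocycle satisfies \<open>\<psi> = \<gamma>\<^sup>*\<psi> - c\<^sub>\<gamma>\<close>, and a Killing field is a quadratic polynomial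
  which is tangential on the circle. At Euclidean distance \<open>\<epsilon>\<close> from a boundary point \<open>\<zeta>\<close>, choose
  \<open>\<gamma>\<close> moving \<open>(1 - \<epsilon>) \<zeta>\<close> into a fixed compact set. Then \<open>\<gamma>\<^sup>*\<psi>\<close> has size \<open>O(\<epsilon>)\<close> there, so
  \<open>\<psi>\<close> is \<open>O(\<epsilon>)\<close>-close to the Killing field \<open>- c\<^sub>\<gamma>\<close> on \<open>{(1 - y) \<zeta> | \<epsilon>/4 \<le> y \<le> \<epsilon>}\<close>. Comparing the
  quadratic polynomials of consecutive dyadic scales shows that their values at \<open>\<zeta>\<close> form a geometric
  Cauchy sequence, so \<open>\<psi>((1 - y) \<zeta>)\<close> converges as \<open>y \<rightarrow> 0\<close>, uniformly in \<open>\<zeta>\<close>, to a limit of these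
  tangential values. Uniform convergence implies \<open>L\<^sup>2\<close>-convergence.\<close>

subsection \<open>Killing fields\<close>

text \<open>The maximum principle for the real parts of \<open>f\<close> and \<open>- f\<close>
  gives \<open>Re f = 0\<close> inside. The image then lies on a vertical line and cannot be open,
  so the open mapping theorem leaves only constants.\<close>

lemma holomorphic_on_ball_const_if_Re_zero_on_sphere:
  assumes hol: "f holomorphic_on ball 0 r" and cont: "continuous_on (cball 0 r) f" and r: "0 < r"
    and Re0: "\<And>z. cmod z = r \<Longrightarrow> Re (f z) = 0"
    and z: "z \<in> ball 0 r"
  shows "f z = f 0"
proof -
  have "Re (f w) \<le> 0" if "w \<in> ball 0 r" for w
    using maximum_real_frontier[of f "ball 0 r" 0 w] hol cont Re0 that r by (simp add: dist_norm)
  moreover have "Re (- f w) \<le> 0" if "w \<in> ball 0 r" for w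
    using maximum_real_frontier[of "\<lambda>z. - f z" "ball 0 r" 0 w] hol cont Re0 that r
    by (simp add: dist_norm holomorphic_on_minus continuous_on_minus)
  ultimately have Re: "Re (f w) = 0" if "w \<in> ball 0 r" for w
    using that by (force intro: antisym)
  have "f constant_on ball 0 r"
  proof (rule ccontr)
    assume "\<not> f constant_on ball 0 r"
    then have "open (f ` ball 0 r)"
      using open_mapping_thm[OF hol _ _ _ subset_refl] by auto
    then obtain e where e: "0 < e" "ball (f 0) e \<subseteq> f ` ball 0 r"
      using r by (meson centre_in_ball imageI openE)
    have "f 0 + of_real (e / 2) \<in> ball (f 0) e"
      using e by (simp add: dist_norm)
    with e obtain w where w: "w \<in> ball 0 r" "f 0 + of_real (e / 2) = f w"
      by blast
    then have "Re (f 0) + e / 2 = Re (f w)"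
      by (metis Re_complex_of_real plus_complex.simps(1))
    then show False using Re[of w] Re[of 0] w r e by simp
  qed
  then show ?thesis
    using z r by (metis centre_in_ball constant_on_def)
qed

text \<open>Infinitesimal isometries are conformal: the trace-free part of the Killing equation is
  the Cauchy-Riemann system. The trace part is the scalar equation, in which the derivative of the
  conformal factor contributes \<open>2 * Re (cnj z * X z)\<close>.\<close>

lemma killing_field_equations:
  assumes "X \<in> killing_fields"
  shows "X holomorphic_on unit_disk"
    and "z \<in> unit_disk \<Longrightarrow> (1 - (cmod z)\<^sup>2) * Re (deriv X z) + 2 * Re (cnj z * X z) = 0"
proof -
  have *: "(X has_field_derivative D z) (at z)
      \<and> (1 - (cmod z)\<^sup>2) * Re (D z) + 2 * Re (cnj z * X z) = 0"
    if D: "D = (\<lambda>z. frechet_derivative X (at z) 1)" and z: "z \<in> unit_disk" for z D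
  proof -
    define L where "L = frechet_derivative X (at z)"
    define u where "u = 1 - (cmod z)\<^sup>2"
    have u: "u > 0" using z by (simp add: u_def abs_square_less_1)
    have "Ck_on unit_disk X (Suc 0)"
      using assms unfolding killing_fields_def smooth_on_def by blast
    then have "X differentiable (at z)" using z by simp
    then have hL: "(X has_derivative L) (at z)"
      by (simp add: L_def frechet_derivative_works)
    have hyp: "frechet_derivative (\<lambda>x. hyp_metric x v w) (at z)
        = (\<lambda>h. 16 * (z \<bullet> h) * (v \<bullet> w) / u ^ 3)" for v w
    proof -
      have eq: "(\<lambda>x. hyp_metric x v w) = (\<lambda>x. 4 / (1 - x \<bullet> x)\<^sup>2 * (v \<bullet> w))"
        by (simp add: hyp_metric_def power2_norm_eq_inner)
      have uz: "1 - z \<bullet> z = u" by (simp add: u_def power2_norm_eq_inner)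
      have der: "((\<lambda>x. 4 / (1 - x \<bullet> x)\<^sup>2 * (v \<bullet> w)) has_derivative
          (\<lambda>h. 16 * (z \<bullet> h) * (v \<bullet> w) / u ^ 3)) (at z)"
        using u uz
        by (auto intro!: derivative_eq_intros simp: fun_eq_iff inner_commute)
          (simp add: divide_simps power2_eq_square power3_eq_cube power4_eq_xxxx)
      show ?thesis
        unfolding eq by (rule frechet_derivative_at[OF der, symmetric])
    qed
    have "lie_hyp_metric X z v w = 0" for v w
      using assms z by (simp add: killing_fields_def)
    moreover have "lie_hyp_metric X z v w
        = 4 / u ^ 3 * (4 * (z \<bullet> X z) * (v \<bullet> w) + u * (L v \<bullet> w + v \<bullet> L w))" for v w
    proof -
      have "lie_hyp_metric X z v w = 16 * (z \<bullet> X z) * (v \<bullet> w) / u ^ 3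
          + 4 / u\<^sup>2 * (L v \<bullet> w) + 4 / u\<^sup>2 * (v \<bullet> L w)"
        unfolding lie_hyp_metric_def hyp by (simp add: hyp_metric_def L_def u_def)
      then show ?thesis
        using u by (simp add: field_simps power2_eq_square power3_eq_cube)
    qed
    ultimately have eq: "4 * (z \<bullet> X z) * (v \<bullet> w) + u * (L v \<bullet> w + v \<bullet> L w) = 0" for v w
      using u by (metis divide_eq_0_iff mult_eq_0_iff less_irrefl power_eq_0_iff zero_neq_numeral)
    \<comment> \<open>The pairs (1, 1) and (i, i) carry the same conformal term, so subtracting them
      compares \<open>Re (L 1)\<close> with \<open>Im (L \<i>)\<close>. For the orthogonal pair (1,
      i) that term drops out. Together these are the Cauchy-Riemann equations.\<close>
    have e11: "2 * (z \<bullet> X z) + u * Re (L 1) = 0" using eq[of 1 1] by (simp add: inner_complex_def)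
    have eii: "2 * (z \<bullet> X z) + u * Im (L \<i>) = 0" using eq[of \<i> \<i>] by (simp add: inner_complex_def)
    have e1i: "Im (L 1) + Re (L \<i>) = 0" using eq[of 1 \<i>] u by (simp add: inner_complex_def)
    have "u * Re (L 1) = u * Im (L \<i>)" using e11 eii by linarith
    then have Li: "L \<i> = \<i> * L 1" using e1i u by (simp add: complex_eq_iff)
    have lin: "linear L" using hL by (rule has_derivative_linear)
    have "L h = L 1 * h" for h
    proof -
      have "L h = L (Re h *\<^sub>R 1 + Im h *\<^sub>R \<i>)"
        by (rule arg_cong[of _ _ L]) (simp add: complex_eq_iff)
      also have "\<dots> = Re h *\<^sub>R L 1 + Im h *\<^sub>R L \<i>"
        by (simp only: linear_add[OF lin] linear_scale[OF lin])
      also have "\<dots> = L 1 * h"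
        by (simp add: Li complex_eq_iff algebra_simps)
      finally show ?thesis .
    qed
    then have "L = (*) (L 1)" by (rule ext)
    then have "(X has_field_derivative L 1) (at z)"
      using hL unfolding has_field_derivative_def by metis
    then show ?thesis
      using e11 by (simp add: D L_def u_def inner_complex_def)
  qed
  show "X holomorphic_on unit_disk"
    unfolding holomorphic_on_open[OF open_ball] using *[OF refl] by blast
  show "(1 - (cmod z)\<^sup>2) * Re (deriv X z) + 2 * Re (cnj z * X z) = 0" if "z \<in> unit_disk"
  proof -
    have "deriv X z = frechet_derivative X (at z) 1"
      using *[OF refl that] by (blast intro: DERIV_imp_deriv)
    then show ?thesis using *[OF refl that] by simp
  qed
qed

text \<open>On each circle of radius \<open>r < 1\<close> the Killing equation says that a
  holomorphic function has zero real part, so this function is constant. The resulting identity is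
  affine in the square of \<open>r\<close>; varying \<open>r\<close> separates it into two equations
  that determine \<open>X\<close>. The Killing equation at 0 makes the linear coefficient
  imaginary.\<close>

lemma killing_field_quadratic:
  assumes "X \<in> killing_fields"
  obtains \<beta> :: complex and t :: real
  where "\<And>z. z \<in> unit_disk \<Longrightarrow> X z = \<beta> + \<i> * of_real t * z - cnj \<beta> * z\<^sup>2"
proof -
  note hol = killing_field_equations(1)[OF assms] and Re = killing_field_equations(2)[OF assms]
  \<comment> \<open>The quotient \<open>X z / z\<close> could have a pole at 0; subtracting
    \<open>X 0\<close> first removes it. The leftover \<open>cnj z * X 0\<close> has the same real
    part as the holomorphic term \<open>z * cnj (X 0)\<close>.\<close>
  define G where "G = (\<lambda>z. if z = 0 then deriv X 0 else (X z - X 0) / (z - 0))"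
  have G: "G holomorphic_on unit_disk"
    unfolding G_def using hol by (rule pole_lemma) simp
  have dX: "deriv X holomorphic_on unit_disk"
    using hol by (rule holomorphic_deriv) simp
  \<comment> \<open>On the circle of radius \<open>r\<close> we have \<open>cnj z = r\<^sup>2 / z\<close>, which makes the Killing equation
    the vanishing of the real part of a holomorphic function.\<close>
  have H: "(1 - of_real (r\<^sup>2)) * deriv X z + 2 * of_real (r\<^sup>2) * G z + 2 * z * cnj (X 0)
      = (1 + of_real (r\<^sup>2)) * deriv X 0" if r: "0 < r" "r < 1" and z: "cmod z < r" for r z
  proof -
    define h where "h = (\<lambda>z. (1 - of_real (r\<^sup>2)) * deriv X z + 2 * of_real (r\<^sup>2) * G z
        + 2 * z * cnj (X 0))"
    have h: "h holomorphic_on unit_disk"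
      unfolding h_def by (intro holomorphic_intros G dX)
    have "h z = h 0"
    proof (rule holomorphic_on_ball_const_if_Re_zero_on_sphere[of h r])
      show "h holomorphic_on ball 0 r"
        using r by (intro holomorphic_on_subset[OF h]) auto
      show "continuous_on (cball 0 r) h"
        using r by (intro holomorphic_on_imp_continuous_on holomorphic_on_subset[OF h]) auto
      show "Re (h w) = 0" if w: "cmod w = r" for w
      proof -
        have w0: "w \<noteq> 0" using w r by auto
        have rw: "of_real (r\<^sup>2) = cnj w * w"
          using complex_norm_square[of w] unfolding w by (simp only: mult.commute)
        have "of_real (r\<^sup>2) * G w = cnj w * X w - cnj w * X 0"
          unfolding rw G_def using w0 by (simp add: field_simps)
        then have "h w = of_real (1 - r\<^sup>2) * deriv X w
            + 2 * (cnj w * X w) - 2 * (cnj w * X 0) + 2 * (w * cnj (X 0))"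
          unfolding h_def of_real_diff of_real_1 by algebra
        then have "Re (h w) = (1 - r\<^sup>2) * Re (deriv X w) + 2 * Re (cnj w * X w)"
          by (simp only: minus_complex.simps plus_complex.simps Re_complex_of_real
              Im_complex_of_real times_complex.simps) simp
        then show ?thesis using Re[of w] w r by simp
      qed
    qed (use r z in auto)
    then show ?thesis by (simp add: h_def G_def algebra_simps)
  qed
  have main: "X z = X 0 + deriv X 0 * z - cnj (X 0) * z\<^sup>2" if z: "z \<in> unit_disk" for z
  proof (cases "z = 0")
    case False
    have z1: "cmod z < 1" using z by simp
    obtain r where r: "cmod z < r" "r < 1" using dense[OF z1] by blast
    obtain s where s: "r < s" "s < 1" using dense[OF r(2)] by blast
    have r0: "0 < r" using r norm_ge_zero[of z] by linarith
    \<comment> \<open>\<open>E\<close> is the coefficient of the squared radius in \<open>H\<close>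
      and \<open>K\<close> is the constant term. Two radii above \<open>cmod z\<close> suffice to
      make both vanish, and \<open>E + K = 0\<close> is then solved for \<open>G z\<close>.\<close>
    define E where "E = - deriv X z + 2 * G z - deriv X 0"
    define K where "K = deriv X z + 2 * z * cnj (X 0) - deriv X 0"
    have "of_real (r\<^sup>2) * E + K = 0"
      using H[OF r0 r(2) r(1)] unfolding E_def K_def by algebra
    moreover have "of_real (s\<^sup>2) * E + K = 0"
      using H[of s z] r r0 s unfolding E_def K_def by (simp add: algebra_simps)
    ultimately have "of_real (s\<^sup>2 - r\<^sup>2) * E = 0" and K: "K = - (of_real (r\<^sup>2) * E)"
      unfolding of_real_diff by (algebra, simp add: eq_neg_iff_add_eq_0 add.commute)
    moreover have "r\<^sup>2 < s\<^sup>2" using r0 s by (simp add: power_strict_mono)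
    ultimately have "E = 0" by (metis diff_gt_0_iff_gt less_irrefl mult_eq_0_iff of_real_eq_0_iff)
    with K have "K = 0" by simp
    with \<open>E = 0\<close> have "2 * (G z - deriv X 0 + z * cnj (X 0)) = 0"
      unfolding E_def K_def by algebra
    then have "G z - deriv X 0 + z * cnj (X 0) = 0"
      by (metis mult_eq_0_iff zero_neq_numeral)
    then have "G z = deriv X 0 - z * cnj (X 0)" by (simp add: algebra_simps)
    then have "X z - X 0 = z * (deriv X 0 - z * cnj (X 0))"
      using False by (simp add: G_def field_simps)
    then show ?thesis by (simp add: algebra_simps power2_eq_square)
  qed simp
  have "Re (deriv X 0) = 0" using Re[of 0] by simp
  then have "deriv X 0 = \<i> * of_real (Im (deriv X 0))" by (simp add: complex_eq_iff)
  then obtain t where t: "deriv X 0 = \<i> * of_real t" by blast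
  show ?thesis using main unfolding t by (rule that)
qed

subsection \<open>Functions approximated by quadratic polynomials at every scale\<close>

text \<open>The values \<open>p\<close>, \<open>q\<close>, \<open>r\<close> at \<open>2 * h\<close>,
  \<open>3 * h\<close>, \<open>4 * h\<close> determine the polynomial. The second difference gives
  \<open>d\<close>, then the first difference gives \<open>b\<close>, then \<open>a\<close> follows:
  the constants are (1 + 2 + 1) / 2 = 2, 1 + 1 + 5 * 2 = 12 and 1 + 2 * 12 + 4 * 2 = 33.\<close>

lemma quadratic_coeff_bounds:
  fixes a b d :: complex and h K :: real
  assumes h: "0 < h"
    and K: "\<And>y. 2 * h \<le> y \<Longrightarrow> y \<le> 4 * h \<Longrightarrow>
      cmod (a + b * of_real y + d * (of_real y)\<^sup>2) \<le> K"
  shows "cmod a \<le> 33 * K" and "cmod b * h \<le> 12 * K" and "cmod d * h\<^sup>2 \<le> 2 * K"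
proof -
  define v where "v = (\<lambda>y. a + b * of_real y + d * (of_real y)\<^sup>2)"
  define p where "p = v (2 * h)"
  define q where "q = v (3 * h)"
  define r where "r = v (4 * h)"
  have pqr: "cmod p \<le> K" "cmod q \<le> K" "cmod r \<le> K"
    unfolding p_def q_def r_def v_def using h by (intro K; simp)+
  have d: "2 * (d * of_real (h\<^sup>2)) = p - 2 * q + r"
    unfolding p_def q_def r_def v_def by (simp add: power2_eq_square algebra_simps)
  have b: "b * of_real h = q - p - 5 * (d * of_real (h\<^sup>2))"
    unfolding p_def q_def v_def by (simp add: power2_eq_square algebra_simps)
  have a: "a = p - 2 * (b * of_real h) - 4 * (d * of_real (h\<^sup>2))"
    unfolding p_def v_def by (simp add: power2_eq_square algebra_simps)
  have "2 * cmod (d * of_real (h\<^sup>2)) = cmod (p - 2 * q + r)"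
    unfolding d[symmetric] norm_mult by simp
  also have "\<dots> \<le> cmod p + 2 * cmod q + cmod r"
    using norm_triangle_ineq[of "p - 2 * q" r] norm_triangle_ineq4[of p "2 * q"]
    by (simp add: norm_mult)
  finally have d': "cmod (d * of_real (h\<^sup>2)) \<le> 2 * K" using pqr by simp
  then show "cmod d * h\<^sup>2 \<le> 2 * K" using h by (simp add: norm_mult norm_power)
  have "cmod (b * of_real h) \<le> cmod q + cmod p + 5 * cmod (d * of_real (h\<^sup>2))"
    unfolding b
    using norm_triangle_ineq4[of "q - p" "5 * (d * of_real (h\<^sup>2))"] norm_triangle_ineq4[of q p]
    by (simp add: norm_mult)
  then have b': "cmod (b * of_real h) \<le> 12 * K" using pqr d' by simp
  then show "cmod b * h \<le> 12 * K" using h by (simp add: norm_mult)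
  have "cmod a \<le> cmod p + 2 * cmod (b * of_real h) + 4 * cmod (d * of_real (h\<^sup>2))"
    by (subst a)
      (use norm_triangle_ineq4[of "p - 2 * (b * of_real h)" "4 * (d * of_real (h\<^sup>2))"]
         norm_triangle_ineq4[of p "2 * (b * of_real h)"] in \<open>simp add: norm_mult\<close>)
  then show "cmod a \<le> 33 * K" using pqr d' b' by simp
qed

lemma geometric_Cauchy_limit:
  fixes A :: "nat \<Rightarrow> complex"
  assumes step: "\<And>n. cmod (A (Suc n) - A n) \<le> c * (1/2) ^ n"
  obtains L where "A \<longlonglongrightarrow> L" and "\<And>n. cmod (A n - L) \<le> 2 * c * (1/2) ^ n"
proof -
  have "0 \<le> c" using order_trans[OF norm_ge_zero step[of 0]] by simp
  \<comment> \<open>Keeping the subtracted term \<open>(1/2) ^ (n + k)\<close> makes the induction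
    close exactly: adding \<open>c * x\<close> turns \<open>- 2 * c * x\<close> into
    \<open>- 2 * c * (x / 2)\<close>.\<close>
  have diff: "cmod (A (n + k) - A n) \<le> 2 * c * ((1/2) ^ n - (1/2) ^ (n + k))" for n k
  proof (induction k)
    case (Suc k)
    have "cmod (A (n + Suc k) - A n) \<le> cmod (A (Suc (n + k)) - A (n + k)) + cmod (A (n + k) - A n)"
      using norm_triangle_ineq[of "A (Suc (n + k)) - A (n + k)" "A (n + k) - A n"] by simp
    also have "\<dots> \<le> c * (1/2) ^ (n + k) + 2 * c * ((1/2) ^ n - (1/2) ^ (n + k))"
      using step Suc.IH by (rule add_mono)
    also have "\<dots> = 2 * c * ((1/2) ^ n - (1/2) ^ (n + Suc k))"
      by (simp add: algebra_simps)
    finally show ?case .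
  qed simp
  have bound: "cmod (A m - A n) \<le> 2 * c * (1/2) ^ n" if "n \<le> m" for m n
  proof -
    have "cmod (A m - A n) \<le> 2 * c * ((1/2) ^ n - (1/2) ^ m)"
      using diff[of n "m - n"] that by simp
    also have "\<dots> \<le> 2 * c * (1/2) ^ n"
      using \<open>0 \<le> c\<close> by (intro mult_left_mono) auto
    finally show ?thesis .
  qed
  have "(\<lambda>n. 2 * c * (1/2) ^ n) \<longlonglongrightarrow> 2 * c * 0"
    by (intro tendsto_intros LIMSEQ_power_zero) simp
  then have lim0: "(\<lambda>n. 2 * c * (1/2) ^ n) \<longlonglongrightarrow> 0" by simp
  have "Cauchy A"
  proof (rule CauchyI')
    fix e :: real assume "0 < e"
    with lim0 obtain N where N: "2 * c * (1/2) ^ N < e / 2"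
      using order_tendstoD(2)[OF lim0, of "e / 2"] by (auto simp: eventually_sequentially)
    have "cmod (A m - A n) < e" if "N \<le> m" "m < n" for m n
    proof -
      have "cmod (A m - A n) \<le> cmod (A m - A N) + cmod (A n - A N)"
        using norm_triangle_ineq4[of "A m - A N" "A n - A N"] by simp
      also have "\<dots> < e" using bound[of N m] bound[of N n] that N by linarith
      finally show ?thesis .
    qed
    then show "\<exists>M. \<forall>m\<ge>M. \<forall>n>m. dist (A m) (A n) < e" by (auto simp: dist_norm)
  qed
  then obtain L where L: "A \<longlonglongrightarrow> L"
    using Cauchy_convergent_iff convergent_def by blast
  have "cmod (A n - L) \<le> 2 * c * (1/2) ^ n" for n
  proof -
    have "(\<lambda>m. A m - A n) \<longlonglongrightarrow> L - A n"
      by (intro tendsto_intros L)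
    then have "cmod (L - A n) \<le> 2 * c * (1/2) ^ n"
      by (rule Lim_norm_ubound[OF sequentially_bot])
        (use bound[of n] in \<open>auto simp: eventually_sequentially\<close>)
    then show ?thesis by (simp add: norm_minus_commute)
  qed
  then show ?thesis using that L by blast
qed

lemma dyadic_scale:
  fixes y :: real
  assumes "0 < y" "y \<le> (1/2) ^ n"
  obtains m where "n \<le> m" "(1/2) ^ Suc m < y" "y \<le> (1/2) ^ m"
proof -
  have "\<exists>k. (1/2) ^ k < y" using real_arch_pow_inv[OF assms(1), of "1/2"] by auto
  then have least: "(1/2) ^ (LEAST k. (1/2) ^ k < y) < y" by (rule LeastI_ex)
  define k where "k = (LEAST k. (1/2) ^ k < y)"
  have k: "(1/2) ^ k < y" using least by (simp add: k_def)
  have "n < k"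
  proof (rule ccontr)
    assume "\<not> n < k"
    then have "(1/2 :: real) ^ n \<le> (1/2) ^ k" by (intro power_decreasing) auto
    then show False using k assms by linarith
  qed
  then obtain m where m: "k = Suc m" by (cases k) auto
  have "\<not> (1/2) ^ m < y"
    using not_less_Least[of m "\<lambda>k. (1/2) ^ k < y"] m by (simp add: k_def)
  then show ?thesis using that[of m] k m \<open>n < k\<close> by auto
qed

text \<open>Approximants at consecutive dyadic scales are close on the overlap of their windows, so
  from scale \<open>n\<close> to the next \<open>a\<close> moves by a multiple of
  \<open>(1/2) ^ n\<close>, \<open>b\<close> by a bounded amount and \<open>d\<close> by a multiple
  of \<open>2 ^ n\<close>. Hence \<open>a\<close> converges geometrically, \<open>b\<close> grows at
  most linearly and \<open>d\<close> at most like \<open>2 ^ n\<close>. For \<open>y\<close> of size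
  \<open>(1/2) ^ n\<close> the non-constant terms are then small, the factor \<open>Suc n\<close>
  coming from \<open>b\<close>. Closedness of \<open>S\<close> puts the limit in
  \<open>S\<close>.\<close>

lemma limit_of_local_quadratic_approximation:
  fixes F :: "real \<Rightarrow> complex"
  assumes C: "0 \<le> C" and M: "0 \<le> M" and S: "closed S"
    and FM: "\<And>y. 1/4 \<le> y \<Longrightarrow> y \<le> 1 \<Longrightarrow> cmod (F y) \<le> M"
    and approx: "\<And>\<epsilon>. 0 < \<epsilon> \<Longrightarrow> \<epsilon> \<le> 1 \<Longrightarrow> \<exists>a b d. a \<in> S \<and> (\<forall>y. \<epsilon> / 4 \<le> y \<longrightarrow> y \<le> \<epsilon> \<longrightarrow>
      cmod (F y - (a + b * of_real y + d * (of_real y)\<^sup>2)) \<le> C * \<epsilon>)"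
  obtains L where "L \<in> S"
    and "\<And>n y. 0 < y \<Longrightarrow> y \<le> (1/2) ^ n \<Longrightarrow>
      cmod (F y - L) \<le> 1600 * (M + C) * (real (Suc n) * (1/2) ^ n)"
proof -
  have "\<forall>n. \<exists>a b d. a \<in> S \<and> (\<forall>y. (1/2) ^ n / 4 \<le> y \<longrightarrow> y \<le> (1/2) ^ n \<longrightarrow>
      cmod (F y - (a + b * of_real y + d * (of_real y)\<^sup>2)) \<le> C * (1/2) ^ n)"
    using approx[of "(1/2) ^ n" for n] by (simp add: power_le_one)
  then obtain a b d where aS: "\<And>n. a n \<in> S"
    and app: "\<And>n y. (1/2) ^ n / 4 \<le> y \<Longrightarrow> y \<le> (1/2) ^ n \<Longrightarrow>
      cmod (F y - (a n + b n * of_real y + d n * (of_real y)\<^sup>2)) \<le> C * (1/2) ^ n"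
    by metis
  \<comment> \<open>The windows of scales \<open>n\<close> and \<open>Suc n\<close> meet where
    \<open>y\<close> is between 1/4 and 1/2 of \<open>(1/2) ^ n\<close>, which is the interval from
    \<open>2 * h\<close> to \<open>4 * h\<close> for \<open>h = (1/2) ^ n / 8\<close>.\<close>
  have step: "cmod (a (Suc n) - a n + (b (Suc n) - b n) * of_real y
      + (d (Suc n) - d n) * (of_real y)\<^sup>2) \<le> 2 * C * (1/2) ^ n"
    if "2 * ((1/2) ^ n / 8) \<le> y" "y \<le> 4 * ((1/2) ^ n / 8)" for n y
  proof -
    let ?p = "F y - (a n + b n * of_real y + d n * (of_real y)\<^sup>2)"
    let ?q = "F y - (a (Suc n) + b (Suc n) * of_real y + d (Suc n) * (of_real y)\<^sup>2)"
    have "0 \<le> (1/2 :: real) ^ n" by simp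
    then have "cmod ?p \<le> C * (1/2) ^ n"
      using that by (intro app) auto
    moreover have "cmod ?q \<le> C * (1/2) ^ Suc n"
      using that by (intro app) auto
    moreover have "a (Suc n) - a n + (b (Suc n) - b n) * of_real y
      + (d (Suc n) - d n) * (of_real y)\<^sup>2 = ?p - ?q" by (simp add: algebra_simps)
    moreover have "C * (1/2) ^ Suc n \<le> C * (1/2) ^ n"
      using C by (intro mult_left_mono) auto
    ultimately show ?thesis using norm_triangle_ineq4[of ?p ?q] by (simp only:)
  qed
  note coeff = quadratic_coeff_bounds[of "(1/2) ^ n / 8" for n, OF _ step, simplified]
  have da: "cmod (a (Suc n) - a n) \<le> 66 * C * (1/2) ^ n" for n
    using coeff(1)[of n n] by simp
  have db: "cmod (b (Suc n) - b n) \<le> 192 * C" for n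
    using coeff(2)[of n n] by simp
  have dd: "cmod (d (Suc n) - d n) \<le> 256 * C * 2 ^ n" for n
    using coeff(3)[of n n] by (simp add: power2_eq_square field_simps)
  \<comment> \<open>The increments control the coefficients only relative to scale 0; the bound
    \<open>M\<close> on \<open>F\<close> away from \<open>y = 0\<close> supplies the start of the
    inductions.\<close>
  have q0: "cmod (a 0 + b 0 * of_real y + d 0 * (of_real y)\<^sup>2) \<le> M + C"
    if "2 * (1/8) \<le> y" "y \<le> 4 * (1/8)" for y
    using app[of 0 y] FM[of y] that
      norm_triangle_ineq2[of "a 0 + b 0 * of_real y + d 0 * (of_real y)\<^sup>2" "F y"]
    by (simp add: norm_minus_commute)
  note coeff0 = quadratic_coeff_bounds[of "1/8", OF _ q0, simplified]
  \<comment> \<open>One constant dominating the initial bounds 96 and 128 times \<open>M + C\<close>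
    and the increments \<open>192 * C\<close> and \<open>256 * C\<close>; the final 1600 is 4 *
    400.\<close>
  define T where "T = 400 * (M + C)"
  have T: "256 * C \<le> T" "128 * (M + C) \<le> T" "0 \<le> T" using M C by (auto simp: T_def)
  have b: "cmod (b n) \<le> T * real (Suc n)" for n
  proof (induction n)
    case 0
    then show ?case using coeff0(2) T by simp
  next
    case (Suc n)
    then show ?case
      using norm_triangle_sub[of "b (Suc n)" "b n"] db[of n] T by (simp add: algebra_simps)
  qed
  have d: "cmod (d n) \<le> T * 2 ^ n" for n
  proof (induction n)
    case 0
    then show ?case using coeff0(3) T by (simp add: power2_eq_square)
  next
    case (Suc n)
    have "256 * C * 2 ^ n \<le> T * 2 ^ n" using T by (intro mult_right_mono) auto
    then show ?case
      using Suc norm_triangle_sub[of "d (Suc n)" "d n"] dd[of n]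
      unfolding power_Suc by linarith
  qed
  obtain L where L: "a \<longlonglongrightarrow> L" and aL: "\<And>n. cmod (a n - L) \<le> 2 * (66 * C) * (1/2) ^ n"
    using geometric_Cauchy_limit[OF da] by metis
  have main: "cmod (F y - L) \<le> 4 * T * (real (Suc n) * (1/2) ^ n)"
    if y: "(1/2) ^ Suc n < y" "y \<le> (1/2) ^ n" for n y
  proof -
    define e :: real where "e = (1/2) ^ n"
    have e: "0 < e" "2 ^ n * e = 1"
      by (auto simp: e_def simp flip: power_mult_distrib)
    have y0: "0 < y" using y by (meson less_trans zero_less_power half_gt_zero zero_less_one)
    have "cmod (b n * of_real y) \<le> (T * real (Suc n)) * e"
      using b[of n] y y0 T unfolding norm_mult by (intro mult_mono) (auto simp: e_def)
    moreover have "cmod (d n * (of_real y)\<^sup>2) \<le> T * e"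
    proof -
      have "cmod (d n * (of_real y)\<^sup>2) \<le> (T * 2 ^ n) * e\<^sup>2"
        using d[of n] y y0 T unfolding norm_mult norm_power
        by (intro mult_mono power_mono) (auto simp: e_def)
      also have "\<dots> = T * (2 ^ n * e) * e" by (simp add: power2_eq_square)
      finally show ?thesis using e by simp
    qed
    moreover have "cmod (F y - (a n + b n * of_real y + d n * (of_real y)\<^sup>2)) \<le> C * e"
      using app[of n y] y e by (simp add: e_def)
    moreover have "cmod (a n - L) \<le> 2 * (66 * C) * e" using aL by (simp add: e_def)
    moreover have "F y - L = (F y - (a n + b n * of_real y + d n * (of_real y)\<^sup>2))
        + (a n - L) + b n * of_real y + d n * (of_real y)\<^sup>2" by simp
    ultimately have "cmod (F y - L) \<le> C * e + 2 * (66 * C) * e + T * real (Suc n) * e + T * e"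
      by (smt (verit) norm_triangle_ineq)
    also have "\<dots> = (133 * C + T) * e + T * (real (Suc n) * e)" by (simp add: algebra_simps)
    also have "\<dots> \<le> 3 * T * (real (Suc n) * e) + T * (real (Suc n) * e)"
    proof -
      have "(133 * C + T) * e \<le> (2 * T) * e"
        using T C e by (intro mult_right_mono) auto
      also have "\<dots> \<le> 3 * T * (real (Suc n) * e)"
        using T e by (intro mult_mono) auto
      finally show ?thesis by (rule add_right_mono)
    qed
    finally show ?thesis by (simp add: e_def algebra_simps)
  qed
  \<comment> \<open>This carries the estimate from the dyadic scale \<open>m\<close> at which
    \<open>y\<close> actually lies to any coarser scale \<open>n\<close>.\<close>
  have mono: "real (Suc m) * (1/2) ^ m \<le> real (Suc n) * (1/2) ^ n" if "n \<le> m" for m n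
    using that
  proof (induction m rule: dec_induct)
    case (step m)
    have "real (Suc (Suc m)) * (1/2) ^ Suc m \<le> real (Suc m) * (1/2) ^ m"
      by (simp add: field_simps)
    then show ?case using step by linarith
  qed simp
  show ?thesis
  proof
    show "L \<in> S" using closed_sequentially[OF S _ L] aS by blast
    fix n and y :: real
    assume "0 < y" "y \<le> (1/2) ^ n"
    then obtain m where m: "n \<le> m" "(1/2) ^ Suc m < y" "y \<le> (1/2) ^ m"
      by (rule dyadic_scale)
    have "cmod (F y - L) \<le> 4 * T * (real (Suc m) * (1/2) ^ m)" using main m by blast
    also have "\<dots> \<le> 4 * T * (real (Suc n) * (1/2) ^ n)"
      using mono[OF m(1)] T by (intro mult_left_mono) auto
    finally show "cmod (F y - L) \<le> 1600 * (M + C) * (real (Suc n) * (1/2) ^ n)"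
      by (simp add: T_def)
  qed
qed

subsection \<open>Cocompact groups of disk automorphisms\<close>

text \<open>Invariance of the hyperbolic metric: the squared modulus of the denominator is the
  reciprocal of the modulus of the derivative. It converts distances to the circle into bounds on
  the derivative.\<close>

lemma one_minus_norm_disk_moebius:
  assumes "(a, b) \<in> SU11" and "z \<in> unit_disk"
  shows "(1 - (cmod (disk_moebius (a, b) z))\<^sup>2) * (cmod (cnj b * z + cnj a))\<^sup>2 = 1 - (cmod z)\<^sup>2"
proof -
  have nz: "cmod (cnj b * z + cnj a) \<noteq> 0"
    using disk_moebius_in_disk(1)[OF assms] by simp
  have "complex_of_real ((cmod (cnj b * z + cnj a))\<^sup>2 - (cmod (a * z + b))\<^sup>2)
      = complex_of_real (((cmod a)\<^sup>2 - (cmod b)\<^sup>2) * (1 - (cmod z)\<^sup>2))"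
    by (simp add: complex_norm_square[unfolded of_real_power] algebra_simps)
  then have "(cmod (cnj b * z + cnj a))\<^sup>2 - (cmod (a * z + b))\<^sup>2 = 1 - (cmod z)\<^sup>2"
    using assms(1) by (simp only: of_real_eq_iff) (simp add: SU11_def)
  moreover have "(1 - (p / q)\<^sup>2) * q\<^sup>2 = q\<^sup>2 - p\<^sup>2" if "q \<noteq> 0" for p q :: real
    using that by (simp add: power_divide left_diff_distrib)
  ultimately show ?thesis
    using assms(2) nz by (simp add: disk_moebius_def norm_divide)
qed

lemma has_field_derivative_disk_moebius:
  assumes "(a, b) \<in> SU11" and "z \<in> unit_disk"
  shows "(disk_moebius (a, b) has_field_derivative 1 / (cnj b * z + cnj a)\<^sup>2) (at z)"
proof (rule has_field_derivative_transform_within_open[OF _ open_ball assms(2)])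
  have nz: "cnj b * z + cnj a \<noteq> 0" using disk_moebius_in_disk(1)[OF assms] .
  have "complex_of_real ((cmod a)\<^sup>2 - (cmod b)\<^sup>2) = 1" using assms(1) by (simp add: SU11_def)
  then have "a * cnj a - b * cnj b = 1"
    by (simp add: complex_norm_square[unfolded of_real_power])
  then have "a * (cnj b * z + cnj a) - (a * z + b) * cnj b = 1" by (simp add: algebra_simps)
  then show "((\<lambda>z. (a * z + b) / (cnj b * z + cnj a)) has_field_derivative
      1 / (cnj b * z + cnj a)\<^sup>2) (at z)"
    using nz by (auto intro!: derivative_eq_intros simp: power2_eq_square)
qed (simp add: disk_moebius_def)

lemma continuous_on_disk_moebius:
  assumes "(a, b) \<in> SU11"
  shows "continuous_on unit_disk (disk_moebius (a, b))"
  using has_field_derivative_disk_moebius[OF assms] DERIV_isCont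
  by (blast intro: continuous_at_imp_continuous_on)

lemma PSU11_elem:
  assumes "g \<in> carrier PSU11"
  obtains a b where "(a, b) \<in> SU11" and "g = disk_moebius (a, b)"
  using assms by (auto simp: PSU11_def)

lemma PSU11_maps_disk:
  assumes "g \<in> carrier PSU11" and "z \<in> unit_disk"
  shows "g z \<in> unit_disk"
  using assms disk_moebius_in_disk(2) by (metis PSU11_elem)

lemma mult_PSU11_apply: "z \<in> unit_disk \<Longrightarrow> (f \<otimes>\<^bsub>PSU11\<^esub> g) z = f (g z)"
  by (simp add: PSU11_def compose_def)

lemma PSU11_transitive:
  assumes "z \<in> unit_disk"
  obtains g where "g \<in> carrier PSU11" and "g 0 = z"
proof -
  \<comment> \<open>Scaling the pair \<open>(1, z)\<close> by \<open>s\<close> puts it in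
    \<open>SU11\<close>, and the associated map sends 0 to \<open>z\<close>.\<close>
  define s where "s = 1 / sqrt (1 - (cmod z)\<^sup>2)"
  have pos: "0 < 1 - (cmod z)\<^sup>2" using assms by (simp add: abs_square_less_1)
  then have s: "0 < s" by (simp add: s_def)
  have "(cmod (of_real s))\<^sup>2 - (cmod (of_real s * z))\<^sup>2 = s\<^sup>2 * (1 - (cmod z)\<^sup>2)"
    by (simp add: norm_mult power_mult_distrib algebra_simps)
  also have "\<dots> = 1" using pos by (simp add: s_def power_divide)
  finally have S: "(of_real s, of_real s * z) \<in> SU11" by (simp add: SU11_def)
  then have "disk_moebius (of_real s, of_real s * z) \<in> carrier PSU11"
    by (simp add: PSU11_def)
  moreover have "disk_moebius (of_real s, of_real s * z) 0 = z"
    using s by (simp add: disk_moebius_def)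
  ultimately show ?thesis by (rule that)
qed

text \<open>Openness in the quotient topology is tested on \<open>SU11\<close>, where the image of 0
  under the map of a pair (a, b) is b / cnj a and so depends continuously on the pair.\<close>

lemma openin_PSU11_topology_orbit_of_0:
  assumes g: "g \<in> carrier PSU11"
  shows "openin PSU11_topology {h \<in> carrier PSU11. cmod (g (h 0)) < r}"
proof -
  have in_disk: "snd x / cnj (fst x) \<in> unit_disk"
    and at0: "disk_moebius x 0 = snd x / cnj (fst x)"
    and nz: "fst x \<noteq> 0" and in_carrier: "disk_moebius x \<in> carrier PSU11" if "x \<in> SU11" for x
    using disk_moebius_in_disk[of "fst x" "snd x" 0] that
    by (auto simp: disk_moebius_def split_beta PSU11_def)
  obtain a b where ab: "(a, b) \<in> SU11" "g = disk_moebius (a, b)"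
    using PSU11_elem[OF g] .
  have "continuous_on SU11 (\<lambda>x. cmod (g (snd x / cnj (fst x))))"
    unfolding ab
    by (intro continuous_on_norm continuous_on_compose2[OF continuous_on_disk_moebius[OF ab(1)]]
        continuous_intros) (use in_disk nz in auto)
  then have "openin (top_of_set SU11) (SU11 \<inter> (\<lambda>x. cmod (g (snd x / cnj (fst x)))) -` {..<r})"
    by (intro continuous_openin_preimage_gen) auto
  also have "SU11 \<inter> (\<lambda>x. cmod (g (snd x / cnj (fst x)))) -` {..<r}
      = {x \<in> SU11. disk_moebius x \<in> {h \<in> carrier PSU11. cmod (g (h 0)) < r}}"
    using at0 in_carrier by auto
  finally show ?thesis
    by (auto simp: PSU11_topology_def openin_quot_topology PSU11_def)
qed

text \<open>The sets \<open>V r\<close> are open unions of cosets and exhaust the group as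
  \<open>r\<close> tends to 1. Compactness of the coset space selects finitely many radii, and
  transitivity of the action turns group elements into points of the disk.\<close>

lemma cocompact_orbit_meets_compact:
  assumes sub: "subgroup \<Gamma> PSU11" and cc: "cocompact_in_PSU11 \<Gamma>"
  obtains R where "0 \<le> R" "R < 1" "\<And>z. z \<in> unit_disk \<Longrightarrow> \<exists>\<gamma>\<in>\<Gamma>. cmod (\<gamma> z) \<le> R"
proof -
  interpret group PSU11 by (rule group_PSU11)
  interpret subgroup \<Gamma> PSU11 by (rule sub)
  define f where "f = (\<lambda>g. \<Gamma> #>\<^bsub>PSU11\<^esub> g)"
  define V where "V = (\<lambda>r. {g \<in> carrier PSU11. \<exists>\<gamma>\<in>\<Gamma>. cmod (\<gamma> (g 0)) < r})"
  have top: "topspace PSU11_topology = carrier PSU11"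
    by (simp add: PSU11_topology_def topspace_quot_topology PSU11_def)
  \<comment> \<open>\<open>V r\<close> is a full preimage under \<open>f\<close>, so its image is
    open in the quotient: if \<open>g = h g'\<close> with \<open>h\<close> in
    \<open>\<Gamma>\<close>, the witness for \<open>g'\<close> composed with the inverse of
    \<open>h\<close> is a witness for \<open>g\<close>.\<close>
  have saturated: "g \<in> V r" if g: "g \<in> carrier PSU11" and fg: "f g \<in> f ` V r" for g r
  proof -
    from fg obtain g' where g': "g' \<in> carrier PSU11" "f g = f g'"
      and "\<exists>\<gamma>\<in>\<Gamma>. cmod (\<gamma> (g' 0)) < r" by (auto simp: V_def)
    then obtain \<gamma> where \<gamma>: "\<gamma> \<in> \<Gamma>" "cmod (\<gamma> (g' 0)) < r" by blast
    have "g \<in> f g'" using rcos_self[OF g sub] g'(2) by (simp add: f_def)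
    then obtain h where h: "h \<in> \<Gamma>" "g = h \<otimes>\<^bsub>PSU11\<^esub> g'" by (auto simp: f_def r_coset_def)
    have eq: "(\<gamma> \<otimes>\<^bsub>PSU11\<^esub> inv\<^bsub>PSU11\<^esub> h) \<otimes>\<^bsub>PSU11\<^esub> g = \<gamma> \<otimes>\<^bsub>PSU11\<^esub> g'"
      using h \<gamma> g' mem_carrier by (simp add: m_assoc flip: m_assoc[of "inv\<^bsub>PSU11\<^esub> h"])
    have "(\<gamma> \<otimes>\<^bsub>PSU11\<^esub> inv\<^bsub>PSU11\<^esub> h) (g 0) = \<gamma> (g' 0)"
      using fun_cong[OF eq, of 0] by (simp add: mult_PSU11_apply)
    moreover have "\<gamma> \<otimes>\<^bsub>PSU11\<^esub> inv\<^bsub>PSU11\<^esub> h \<in> \<Gamma>" using \<gamma> h by simp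
    ultimately show ?thesis using \<gamma>(2) g unfolding V_def by (intro CollectI conjI bexI) simp_all
  qed
  have openV: "openin PSU11_topology (V r)" for r
  proof -
    have "V r = (\<Union>\<gamma>\<in>\<Gamma>. {h \<in> carrier PSU11. cmod (\<gamma> (h 0)) < r})" by (auto simp: V_def)
    then show ?thesis
      using openin_PSU11_topology_orbit_of_0[OF mem_carrier] by auto
  qed
  have "openin (quot_topology PSU11_topology f) (f ` V r)" for r
  proof -
    have "V r \<subseteq> carrier PSU11" by (auto simp: V_def)
    then have "{x \<in> topspace PSU11_topology. f x \<in> f ` V r} = V r"
      using saturated by (auto simp: top)
    then show ?thesis
      using openV by (auto simp: openin_quot_topology top V_def)
  qed
  moreover have "topspace (quot_topology PSU11_topology f) \<subseteq> \<Union> ((\<lambda>r. f ` V r) ` {..<1})"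
  proof -
    have "g \<in> (\<Union>r<1. V r)" if g: "g \<in> carrier PSU11" for g
    proof -
      have "g 0 \<in> unit_disk" using PSU11_maps_disk[OF g] by simp
      then have "cmod (\<one>\<^bsub>PSU11\<^esub> (g 0)) < 1" by (simp add: PSU11_def)
      then obtain r where "cmod (\<one>\<^bsub>PSU11\<^esub> (g 0)) < r" "r < 1" using dense by blast
      then show ?thesis using g subgroup.one_closed[OF sub] by (fastforce simp: V_def)
    qed
    then show ?thesis by (force simp: topspace_quot_topology top)
  qed
  ultimately obtain \<F> where \<F>: "finite \<F>" "\<F> \<subseteq> (\<lambda>r. f ` V r) ` {..<1}"
      "topspace (quot_topology PSU11_topology f) \<subseteq> \<Union> \<F>"
    using cc unfolding cocompact_in_PSU11_def compact_space_def compactin_def f_def[symmetric]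
    by (smt (verit, best) imageE)
  obtain rs where rs: "rs \<subseteq> {..<1}" "finite rs" "\<F> = (\<lambda>r. f ` V r) ` rs"
    using finite_subset_image[OF \<F>(1,2)] by blast
  \<comment> \<open>Inserting 0 keeps the maximum defined when \<open>rs\<close> is empty and
    nonnegative when its radii are negative.\<close>
  define R where "R = Max (insert 0 rs)"
  show ?thesis
  proof
    show "0 \<le> R" "R < 1" using rs by (auto simp: R_def)
    fix z assume "z \<in> unit_disk"
    then obtain g where g: "g \<in> carrier PSU11" "g 0 = z" by (rule PSU11_transitive)
    have "f g \<in> \<Union> \<F>" using \<F>(3) g by (auto simp: topspace_quot_topology top)
    then obtain r where r: "r \<in> rs" "f g \<in> f ` V r" using rs by auto
    then have "g \<in> V r" using saturated g by blast
    then obtain \<gamma> where "\<gamma> \<in> \<Gamma>" "cmod (\<gamma> z) < r" using g by (auto simp: V_def)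
    moreover have "r \<le> R" using r rs by (simp add: R_def)
    ultimately show "\<exists>\<gamma>\<in>\<Gamma>. cmod (\<gamma> z) \<le> R" by force
  qed
qed

text \<open>The denominator \<open>j\<close> is affine in \<open>z\<close> and at most doubles from
  \<open>z0\<close> to \<open>z\<close>. The invariance identity at \<open>z0\<close>, whose image
  stays in the ball of radius \<open>R\<close>, bounds \<open>j z0\<close>; squaring the doubling
  turns 2 into 8. The same identity at \<open>z\<close>, whose distance to the circle is at least
  \<epsilon> / 4, keeps the image of \<open>z\<close> in a larger fixed ball, with 32 = 4 *
  8.\<close>

lemma radial_derivative_bound:
  assumes ab: "(a, b) \<in> SU11" and \<zeta>: "cmod \<zeta> = 1" and \<epsilon>: "0 < \<epsilon>" "\<epsilon> \<le> 1"
    and R: "0 \<le> R" "R < 1" "cmod (disk_moebius (a, b) (of_real (1 - \<epsilon>) * \<zeta>)) \<le> R"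
    and y: "\<epsilon> / 4 \<le> y" "y \<le> \<epsilon>" and z: "z = of_real (1 - y) * \<zeta>"
  shows "(cmod (cnj b * z + cnj a))\<^sup>2 \<le> 8 * \<epsilon> / (1 - R\<^sup>2)"
    and "cmod (disk_moebius (a, b) z) \<le> sqrt (1 - (1 - R\<^sup>2) / 32)"
proof -
  define z0 where "z0 = of_real (1 - \<epsilon>) * \<zeta>"
  define j where "j = (\<lambda>z. cnj b * z + cnj a)"
  have norms: "cmod z0 = 1 - \<epsilon>" "cmod z = 1 - y"
    using \<epsilon> y \<zeta> by (simp_all only: z z0_def norm_mult norm_of_real) auto
  have disk: "z0 \<in> unit_disk" "z \<in> unit_disk" using norms \<epsilon> y by auto
  have ab': "cmod b \<le> cmod a"
  proof -
    have "(cmod a)\<^sup>2 - (cmod b)\<^sup>2 = 1" using ab by (simp add: SU11_def)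
    then have "(cmod b)\<^sup>2 \<le> (cmod a)\<^sup>2" by linarith
    then show ?thesis by (rule power2_le_imp_le) simp
  qed
  have R1: "0 < 1 - R\<^sup>2" using R by (simp add: abs_square_less_1)
  \<comment> \<open>Since \<open>cmod b \<le> cmod a\<close> and
    \<open>cmod z0 = 1 - \<epsilon>\<close>, the two terms of \<open>j z0\<close> cannot cancel
    below \<open>cmod b * \<epsilon>\<close>, which is also the most that \<open>j\<close> can
    change between \<open>z0\<close> and \<open>z\<close>.\<close>
  have "cmod b * \<epsilon> \<le> cmod a - cmod b * cmod z0"
    using ab' by (simp add: norms algebra_simps)
  also have "\<dots> \<le> cmod (j z0)"
    using norm_triangle_ineq2[of "cnj a" "- (cnj b * z0)"] by (simp add: j_def norm_mult add.commute)
  finally have b: "cmod b * \<epsilon> \<le> cmod (j z0)" .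
  have "cmod (j z) \<le> cmod (j z0) + cmod b * cmod (z - z0)"
  proof -
    have "j z = j z0 + cnj b * (z - z0)" by (simp add: j_def algebra_simps)
    then show ?thesis using norm_triangle_ineq[of "j z0" "cnj b * (z - z0)"] by (simp add: norm_mult)
  qed
  moreover have "cmod (z - z0) \<le> \<epsilon>"
  proof -
    have "z - z0 = of_real (\<epsilon> - y) * \<zeta>" by (simp add: z z0_def algebra_simps)
    then have "cmod (z - z0) = \<epsilon> - y" using y \<zeta> by (simp only: norm_mult norm_of_real) simp
    then show ?thesis using \<epsilon> y by simp
  qed
  then have "cmod b * cmod (z - z0) \<le> cmod b * \<epsilon>" by (rule mult_left_mono) simp
  ultimately have "cmod (j z) \<le> 2 * cmod (j z0)" using b by linarith
  then have "(cmod (j z))\<^sup>2 \<le> (2 * cmod (j z0))\<^sup>2" by (rule power_mono) simp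
  then have jz: "(cmod (j z))\<^sup>2 \<le> 4 * (cmod (j z0))\<^sup>2" by (simp add: power_mult_distrib)
  have "(1 - R\<^sup>2) * (cmod (j z0))\<^sup>2
      \<le> (1 - (cmod (disk_moebius (a, b) z0))\<^sup>2) * (cmod (j z0))\<^sup>2"
    using R(3) by (intro mult_right_mono) (auto simp: z0_def intro!: power_mono)
  also have "\<dots> = 1 - (1 - \<epsilon>)\<^sup>2"
    using one_minus_norm_disk_moebius[OF ab disk(1)] by (simp add: j_def norms)
  also have "\<dots> \<le> 2 * \<epsilon>" by (simp add: power2_eq_square algebra_simps)
  finally have "(cmod (j z0))\<^sup>2 \<le> 2 * \<epsilon> / (1 - R\<^sup>2)" using R1 by (simp add: field_simps)
  then have J: "(cmod (j z))\<^sup>2 \<le> 8 * \<epsilon> / (1 - R\<^sup>2)" using jz by simp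
  then show "(cmod (cnj b * z + cnj a))\<^sup>2 \<le> 8 * \<epsilon> / (1 - R\<^sup>2)" by (simp add: j_def)
  define u where "u = 1 - (cmod (disk_moebius (a, b) z))\<^sup>2"
  have u: "0 \<le> u"
    using disk_moebius_in_disk(2)[OF ab disk(2)] by (simp add: u_def abs_square_le_1)
  have "\<epsilon> / 4 \<le> 1 - (1 - y)\<^sup>2"
  proof -
    have "y * y \<le> y * 1" using y \<epsilon> by (intro mult_left_mono) auto
    then show ?thesis using y by (simp add: power2_eq_square algebra_simps)
  qed
  also have "\<dots> = u * (cmod (j z))\<^sup>2"
    using one_minus_norm_disk_moebius[OF ab disk(2)] by (simp add: j_def u_def norms)
  also have "\<dots> \<le> u * (8 * \<epsilon> / (1 - R\<^sup>2))" using J u by (rule mult_left_mono)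
  finally have "\<epsilon> * ((1 - R\<^sup>2) / 32) \<le> \<epsilon> * u" using R1 by (simp add: field_simps)
  then have "(1 - R\<^sup>2) / 32 \<le> u" using \<epsilon> by (simp only: mult_le_cancel_left_pos)
  then have "(cmod (disk_moebius (a, b) z))\<^sup>2 \<le> 1 - (1 - R\<^sup>2) / 32" unfolding u_def by linarith
  then show "cmod (disk_moebius (a, b) z) \<le> sqrt (1 - (1 - R\<^sup>2) / 32)"
    by (rule real_le_rsqrt)
qed

subsection \<open>The averaged cocycle\<close>

text \<open>Right multiplication by \<open>\<delta>\<close> permutes \<open>\<Gamma>\<close>. After
  this reindexing the cocycle relation splits each term in two: the first parts sum to the pullback
  of \<open>- \<psi>\<close>, the second to \<open>c \<delta> z\<close> because the weights at
  \<open>\<delta> z\<close> add up to 1.\<close>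

lemma averaged_cocycle_equivariant:
  assumes sub: "subgroup \<Gamma> PSU11"
    and fin: "\<And>z. z \<in> unit_disk \<Longrightarrow> finite {\<gamma> \<in> \<Gamma>. \<phi> (\<gamma> z) \<noteq> 0}"
    and sum1: "\<And>z. z \<in> unit_disk \<Longrightarrow> (\<Sum>\<^sub>\<infinity>\<gamma>\<in>\<Gamma>. \<phi> (\<gamma> z)) = 1"
    and coc: "cocycle \<Gamma> c"
    and \<psi>: "\<And>z. z \<in> unit_disk \<Longrightarrow> \<psi> z = - (\<Sum>\<^sub>\<infinity>\<gamma>\<in>\<Gamma>. \<phi> (\<gamma> z) *\<^sub>R c \<gamma> z)"
    and \<delta>: "\<delta> \<in> \<Gamma>" and z: "z \<in> unit_disk"
  shows "\<psi> z = pullback \<delta> \<psi> z - c \<delta> z"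
proof -
  interpret group PSU11 by (rule group_PSU11)
  interpret subgroup \<Gamma> PSU11 by (rule sub)
  define w where "w = \<delta> z"
  define k where "k = inverse (deriv \<delta> z)"
  have w: "w \<in> unit_disk" unfolding w_def using PSU11_maps_disk \<delta> z mem_carrier by blast
  have bij: "bij_betw (\<lambda>\<gamma>. \<gamma> \<otimes>\<^bsub>PSU11\<^esub> \<delta>) \<Gamma> \<Gamma>"
    by (rule bij_betwI[where g = "\<lambda>\<gamma>. \<gamma> \<otimes>\<^bsub>PSU11\<^esub> inv\<^bsub>PSU11\<^esub> \<delta>"])
      (use \<delta> mem_carrier in \<open>auto simp: m_assoc\<close>)
  have summable: "(\<lambda>\<gamma>. \<phi> (\<gamma> w) *\<^sub>R X \<gamma>) summable_on \<Gamma>" for X :: "_ \<Rightarrow> complex"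
    by (rule finite_nonzero_values_imp_summable_on, rule finite_subset[OF _ fin[OF w]]) auto
  have summable_\<phi>: "(\<lambda>\<gamma>. \<phi> (\<gamma> w)) summable_on \<Gamma>"
    by (rule finite_nonzero_values_imp_summable_on, rule fin[OF w])
  have "- \<psi> z = (\<Sum>\<^sub>\<infinity>\<gamma>\<in>\<Gamma>. \<phi> ((\<gamma> \<otimes>\<^bsub>PSU11\<^esub> \<delta>) z) *\<^sub>R c (\<gamma> \<otimes>\<^bsub>PSU11\<^esub> \<delta>) z)"
    using \<psi>[OF z] infsum_reindex_bij_betw[OF bij, of "\<lambda>\<gamma>. \<phi> (\<gamma> z) *\<^sub>R c \<gamma> z"] by simp
  also have "\<dots> = (\<Sum>\<^sub>\<infinity>\<gamma>\<in>\<Gamma>. \<phi> (\<gamma> w) *\<^sub>R c \<gamma> w * k + \<phi> (\<gamma> w) *\<^sub>R c \<delta> z)"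
    using coc \<delta> z
    by (intro infsum_cong)
      (simp add: cocycle_def pullback_def mult_PSU11_apply w_def k_def scaleR_add_right)
  also have "\<dots> = (\<Sum>\<^sub>\<infinity>\<gamma>\<in>\<Gamma>. \<phi> (\<gamma> w) *\<^sub>R c \<gamma> w * k) + (\<Sum>\<^sub>\<infinity>\<gamma>\<in>\<Gamma>. \<phi> (\<gamma> w) *\<^sub>R c \<delta> z)"
    using summable[of "\<lambda>\<gamma>. c \<gamma> w * k"] summable[of "\<lambda>\<gamma>. c \<delta> z"]
    by (intro infsum_add) simp_all
  also have "(\<Sum>\<^sub>\<infinity>\<gamma>\<in>\<Gamma>. \<phi> (\<gamma> w) *\<^sub>R c \<gamma> w * k) = - \<psi> w * k"
    using \<psi>[OF w] by (simp only: infsum_cmult_left') simp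
  also have "(\<Sum>\<^sub>\<infinity>\<gamma>\<in>\<Gamma>. \<phi> (\<gamma> w) *\<^sub>R c \<delta> z) = c \<delta> z"
    using sum1[OF w] summable_\<phi> by (simp add: infsum_scaleR_left)
  finally show ?thesis
    by (simp add: pullback_def w_def k_def algebra_simps minus_equation_iff[of "\<psi> z"])
qed

text \<open>On a neighborhood given by local finiteness the infinite sum is a sum over one fixed
  finite set \<open>S\<close>.\<close>

lemma continuous_on_averaged_cocycle:
  assumes sub: "subgroup \<Gamma> PSU11"
    and \<phi>: "continuous_on unit_disk \<phi>"
    and locfin: "\<And>z. z \<in> unit_disk \<Longrightarrow>
      \<exists>U S. open U \<and> z \<in> U \<and> U \<subseteq> unit_disk \<and> finite S \<and> S \<subseteq> \<Gamma> \<and>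
        (\<forall>\<gamma>\<in>\<Gamma> - S. \<forall>w\<in>\<gamma> ` U. \<phi> w = 0)"
    and c: "\<And>\<gamma>. \<gamma> \<in> \<Gamma> \<Longrightarrow> continuous_on unit_disk (c \<gamma>)"
    and \<psi>: "\<And>z. z \<in> unit_disk \<Longrightarrow> \<psi> z = - (\<Sum>\<^sub>\<infinity>\<gamma>\<in>\<Gamma>. \<phi> (\<gamma> z) *\<^sub>R c \<gamma> z)"
  shows "continuous_on unit_disk (\<psi> :: complex \<Rightarrow> complex)"
proof (rule continuous_at_imp_continuous_on, rule ballI)
  interpret subgroup \<Gamma> PSU11 by (rule sub)
  fix z :: complex assume "z \<in> unit_disk"
  from locfin[OF this] obtain U S where U: "open U" "z \<in> U" "U \<subseteq> unit_disk"
    and S: "finite S" "S \<subseteq> \<Gamma>" "\<forall>\<gamma>\<in>\<Gamma> - S. \<forall>w\<in>\<gamma> ` U. \<phi> w = 0" by blast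
  have \<phi>\<gamma>: "continuous_on unit_disk (\<lambda>z. \<phi> (\<gamma> z))" if "\<gamma> \<in> \<Gamma>" for \<gamma>
  proof -
    have \<gamma>: "\<gamma> \<in> carrier PSU11" using that by (rule mem_carrier)
    then have "continuous_on unit_disk \<gamma>"
      by (metis PSU11_elem continuous_on_disk_moebius)
    then show ?thesis
      using PSU11_maps_disk[OF \<gamma>] by (intro continuous_on_compose2[OF \<phi>]) auto
  qed
  have eq: "\<psi> w = - (\<Sum>\<gamma>\<in>S. \<phi> (\<gamma> w) *\<^sub>R c \<gamma> w)" if "w \<in> U" for w
  proof -
    have "(\<Sum>\<^sub>\<infinity>\<gamma>\<in>\<Gamma>. \<phi> (\<gamma> w) *\<^sub>R c \<gamma> w) = (\<Sum>\<^sub>\<infinity>\<gamma>\<in>S. \<phi> (\<gamma> w) *\<^sub>R c \<gamma> w)"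
      using S that by (intro infsum_cong_neutral) auto
    then show ?thesis using \<psi>[of w] that U S by auto
  qed
  have "continuous_on U (\<lambda>w. - (\<Sum>\<gamma>\<in>S. \<phi> (\<gamma> w) *\<^sub>R c \<gamma> w))"
    using S(2) U(3) continuous_on_subset[OF \<phi>\<gamma>] continuous_on_subset[OF c]
    by (intro continuous_intros) blast+
  then have "continuous_on U \<psi>" using eq by (simp cong: continuous_on_cong)
  then show "isCont \<psi> z" using U by (simp add: continuous_on_eq_continuous_at)
qed

subsection \<open>Radial limits\<close>

text \<open>Along each radius the defect \<open>\<psi> + c \<gamma>\<close> is the pullback of
  \<open>\<psi>\<close>, namely a value of \<open>\<psi>\<close> on a fixed compact ball times the
  square of the denominator of \<open>\<gamma>\<close>, hence of order \<epsilon>. The constants do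
  not depend on \<zeta>, so a single \<open>K\<close> serves the whole circle.\<close>

lemma radial_limits_of_equivariant_field:
  fixes \<psi> :: "complex \<Rightarrow> complex"
  assumes sub: "subgroup \<Gamma> PSU11" and cc: "cocompact_in_PSU11 \<Gamma>"
    and cont: "continuous_on unit_disk \<psi>"
    and killing: "\<And>\<gamma>. \<gamma> \<in> \<Gamma> \<Longrightarrow> c \<gamma> \<in> killing_fields"
    and equi: "\<And>\<gamma> z. \<gamma> \<in> \<Gamma> \<Longrightarrow> z \<in> unit_disk \<Longrightarrow> \<psi> z = pullback \<gamma> \<psi> z - c \<gamma> z"
  obtains K where "\<And>\<zeta>. cmod \<zeta> = 1 \<Longrightarrow> \<exists>L. Re (cnj \<zeta> * L) = 0 \<and>
    (\<forall>n y. 0 < y \<longrightarrow> y \<le> (1/2) ^ n \<longrightarrow>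
      cmod (\<psi> (of_real (1 - y) * \<zeta>) - L) \<le> K * (real (Suc n) * (1/2) ^ n))"
proof -
  obtain R where R: "0 \<le> R" "R < 1" and orbit: "\<And>z. z \<in> unit_disk \<Longrightarrow> \<exists>\<gamma>\<in>\<Gamma>. cmod (\<gamma> z) \<le> R"
    using cocompact_orbit_meets_compact[OF sub cc] by metis
  have R1: "0 < 1 - R\<^sup>2" using R by (simp add: abs_square_less_1)
  \<comment> \<open>The ball has to contain the images from \<open>radial_derivative_bound\<close>
    and also the points with \<open>1/4 \<le> y\<close>, of modulus at most 3/4, where the limit
    lemma needs its initial bound.\<close>
  define R' where "R' = max (3/4) (sqrt (1 - (1 - R\<^sup>2) / 32))"
  have "R' < 1" using R1 by (auto simp: R'_def real_sqrt_lt_1_iff)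
  then have "compact (\<psi> ` cball 0 R')"
    by (intro compact_continuous_image continuous_on_subset[OF cont]) auto
  then obtain M where "0 < M" and M: "\<And>w. cmod w \<le> R' \<Longrightarrow> cmod (\<psi> w) \<le> M"
    using compact_imp_bounded bounded_pos by (metis imageI mem_cball_0)
  define C where "C = M * 8 / (1 - R\<^sup>2)"
  have "0 \<le> C" using \<open>0 < M\<close> R1 by (simp add: C_def)
  have "\<exists>L. Re (cnj \<zeta> * L) = 0 \<and> (\<forall>n y. 0 < y \<longrightarrow> y \<le> (1/2) ^ n \<longrightarrow>
      cmod (\<psi> (of_real (1 - y) * \<zeta>) - L) \<le> 1600 * (M + C) * (real (Suc n) * (1/2) ^ n))"
    if \<zeta>: "cmod \<zeta> = 1" for \<zeta>
  proof -
    have radius: "cmod (of_real (1 - y) * \<zeta>) = 1 - y" if "y \<le> 1" for y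
      using that \<zeta> by (simp only: norm_mult norm_of_real) simp
    have "\<exists>A B D. A \<in> {w. Re (cnj \<zeta> * w) = 0} \<and> (\<forall>y. \<epsilon> / 4 \<le> y \<longrightarrow> y \<le> \<epsilon> \<longrightarrow>
        cmod (\<psi> (of_real (1 - y) * \<zeta>) - (A + B * of_real y + D * (of_real y)\<^sup>2)) \<le> C * \<epsilon>)"
      if \<epsilon>: "0 < \<epsilon>" "\<epsilon> \<le> 1" for \<epsilon>
    proof -
      have "of_real (1 - \<epsilon>) * \<zeta> \<in> unit_disk" using radius \<epsilon> by simp
      then obtain \<gamma> where \<gamma>: "\<gamma> \<in> \<Gamma>" "cmod (\<gamma> (of_real (1 - \<epsilon>) * \<zeta>)) \<le> R"
        using orbit by blast
      obtain a b where ab: "(a, b) \<in> SU11" and \<gamma>ab: "\<gamma> = disk_moebius (a, b)"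
        using PSU11_elem subgroup.mem_carrier[OF sub \<gamma>(1)] by metis
      obtain \<beta> t where c: "\<And>z. z \<in> unit_disk \<Longrightarrow> c \<gamma> z = \<beta> + \<i> * of_real t * z - cnj \<beta> * z\<^sup>2"
        using killing_field_quadratic[OF killing[OF \<gamma>(1)]] by metis
      \<comment> \<open>Coefficients of \<open>- c \<gamma>\<close> at
        \<open>(1 - y) \<zeta>\<close> expanded in powers of \<open>y\<close>; \<open>A\<close> is
        the value of the polynomial at \<zeta> itself.\<close>
      define A where "A = - (\<beta> + \<i> * of_real t * \<zeta> - cnj \<beta> * \<zeta>\<^sup>2)"
      define B where "B = \<i> * of_real t * \<zeta> - 2 * cnj \<beta> * \<zeta>\<^sup>2"
      define D where "D = cnj \<beta> * \<zeta>\<^sup>2"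
      have "cnj \<zeta> * \<zeta> = 1" using complex_norm_square[of \<zeta>] \<zeta> by (simp add: mult.commute)
      \<comment> \<open>With \<open>u = cnj \<beta> * \<zeta>\<close> the right side is
        \<open>u - cnj u\<close> minus an imaginary number: Killing fields are tangential on the
        circle.\<close>
      then have "cnj \<zeta> * A = cnj (cnj \<beta> * \<zeta>) * (- 1) - \<i> * of_real t + cnj \<beta> * \<zeta>"
        unfolding A_def complex_cnj_mult complex_cnj_cnj by algebra
      then have "Re (cnj \<zeta> * A) = 0" by simp
      moreover have "cmod (\<psi> (of_real (1 - y) * \<zeta>) - (A + B * of_real y + D * (of_real y)\<^sup>2)) \<le> C * \<epsilon>"
        if y: "\<epsilon> / 4 \<le> y" "y \<le> \<epsilon>" for y
      proof -
        define z where "z = of_real (1 - y) * \<zeta>"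
        have z: "z \<in> unit_disk" using radius[of y] y \<epsilon> by (simp add: z_def)
        note bounds = radial_derivative_bound[OF ab \<zeta> \<epsilon> R \<gamma>(2)[unfolded \<gamma>ab] y z_def]
        have "A + B * of_real y + D * (of_real y)\<^sup>2 = - c \<gamma> z"
          unfolding c[OF z]
          unfolding A_def B_def D_def z_def of_real_diff of_real_1 by algebra
        moreover have "deriv \<gamma> z = 1 / (cnj b * z + cnj a)\<^sup>2"
          unfolding \<gamma>ab by (rule DERIV_imp_deriv[OF has_field_derivative_disk_moebius[OF ab z]])
        ultimately have "\<psi> z - (A + B * of_real y + D * (of_real y)\<^sup>2)
            = \<psi> (\<gamma> z) * (cnj b * z + cnj a)\<^sup>2"
          using equi[OF \<gamma>(1) z] by (simp add: pullback_def)
        then have "cmod (\<psi> z - (A + B * of_real y + D * (of_real y)\<^sup>2))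
            = cmod (\<psi> (\<gamma> z)) * (cmod (cnj b * z + cnj a))\<^sup>2"
          by (simp add: norm_mult norm_power)
        also have "\<dots> \<le> M * (8 * \<epsilon> / (1 - R\<^sup>2))"
          using bounds \<open>0 < M\<close> by (intro mult_mono M) (auto simp: R'_def \<gamma>ab)
        finally show ?thesis by (simp add: C_def z_def)
      qed
      ultimately show ?thesis by blast
    qed
    moreover have "closed {w. Re (cnj \<zeta> * w) = 0}"
      by (intro closed_Collect_eq continuous_intros)
    moreover have "cmod (\<psi> (of_real (1 - y) * \<zeta>)) \<le> M" if "1/4 \<le> y" "y \<le> 1" for y
      using radius[of y] that by (intro M) (simp add: R'_def)
    ultimately obtain L where "L \<in> {w. Re (cnj \<zeta> * w) = 0}"
      "\<And>n y. 0 < y \<Longrightarrow> y \<le> (1/2) ^ n \<Longrightarrow>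
        cmod (\<psi> (of_real (1 - y) * \<zeta>) - L) \<le> 1600 * (M + C) * (real (Suc n) * (1/2) ^ n)"
      using limit_of_local_quadratic_approximation[of C M "{w. Re (cnj \<zeta> * w) = 0}"
          "\<lambda>y. \<psi> (of_real (1 - y) * \<zeta>)"] \<open>0 \<le> C\<close> \<open>0 < M\<close> by (metis (no_types, lifting) less_imp_le)
    then show ?thesis by blast
  qed
  then show ?thesis by (rule that)
qed

subsection \<open>Convergence on the circle\<close>

lemma space_circle_measure [simp]: "space circle_measure = sphere 0 1"
  by (simp add: circle_measure_def space_restrict_space)

lemma sets_circle_measure [simp, measurable_cong]:
  "sets circle_measure = sets (restrict_space borel (sphere 0 1))"
  by (simp add: circle_measure_def)

lemma measure_circle_measure: "measure circle_measure (sphere 0 1) = 2 * pi"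
  by (simp add: measure_def emeasure_circle_measure)

lemma finite_measure_circle_measure: "finite_measure circle_measure"
  by (rule finite_measureI) (simp add: emeasure_circle_measure)

lemma norm_diff_squared_le: "(cmod (x - y))\<^sup>2 \<le> 2 * (cmod x)\<^sup>2 + 2 * (cmod y)\<^sup>2"
proof -
  have "(cmod (x - y))\<^sup>2 \<le> (cmod x + cmod y)\<^sup>2"
    by (intro power_mono norm_triangle_ineq4) simp
  also have "\<dots> \<le> 2 * (cmod x)\<^sup>2 + 2 * (cmod y)\<^sup>2"
    using sum_squares_bound[of "cmod x" "cmod y"] by (simp add: power2_sum)
  finally show ?thesis .
qed

lemma L2_circle_integrable_diff:
  assumes "L2_circle F" and "L2_circle G"
  shows "integrable circle_measure (\<lambda>z. (cmod (F z - G z))\<^sup>2)"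
proof (rule Bochner_Integration.integrable_bound)
  show "integrable circle_measure (\<lambda>z. 2 * (cmod (F z))\<^sup>2 + 2 * (cmod (G z))\<^sup>2)"
    using assms unfolding L2_circle_def by (intro Bochner_Integration.integrable_add) auto
  have "F \<in> borel_measurable circle_measure" "G \<in> borel_measurable circle_measure"
    using assms by (auto simp: L2_circle_def)
  then show "(\<lambda>z. (cmod (F z - G z))\<^sup>2) \<in> borel_measurable circle_measure"
    by measurable
  show "AE z in circle_measure. norm ((cmod (F z - G z))\<^sup>2)
      \<le> norm (2 * (cmod (F z))\<^sup>2 + 2 * (cmod (G z))\<^sup>2)"
    using norm_diff_squared_le by (intro AE_I2) simp
qed

text \<open>In terms of squared distances, \<open>norm_diff_squared_le\<close> takes the place of
  Minkowski's inequality: the distance of the two limits is bounded by quantities tending to 0, and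
  a nonnegative function with zero integral vanishes almost everywhere.\<close>

lemma L2_circle_tendsto_unique:
  assumes A: "A \<noteq> bot" and G: "L2_circle_tendsto F G A" and G': "L2_circle_tendsto F G' A"
  shows "AE z in circle_measure. G z = G' z"
proof -
  define I where "I = (\<lambda>F G. LINT z|circle_measure. (cmod (F z - G z))\<^sup>2)"
  have L2: "L2_circle G" "L2_circle G'" "\<forall>\<^sub>F i in A. L2_circle (F i)"
    using G G' by (auto simp: L2_circle_tendsto_def)
  have lim: "((\<lambda>i. I (F i) H) \<longlongrightarrow> 0) A" if "L2_circle_tendsto F H A" for H
  proof -
    have "((\<lambda>i. sqrt (I (F i) H)) \<longlongrightarrow> 0) A" using that by (simp add: L2_circle_tendsto_def I_def)
    then have "((\<lambda>i. (sqrt (I (F i) H))\<^sup>2) \<longlongrightarrow> 0\<^sup>2) A" by (rule tendsto_power)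
    moreover have "0 \<le> I (F i) H" for i by (simp add: I_def)
    ultimately show ?thesis by simp
  qed
  have ev: "\<forall>\<^sub>F i in A. I G G' \<le> 2 * I (F i) G + 2 * I (F i) G'"
    using L2(3)
  proof eventually_elim
    case (elim i)
    note int = L2_circle_integrable_diff[OF elim L2(1)] L2_circle_integrable_diff[OF elim L2(2)]
    have "I G G' \<le> (LINT z|circle_measure. 2 * (cmod (F i z - G z))\<^sup>2 + 2 * (cmod (F i z - G' z))\<^sup>2)"
      unfolding I_def
    proof (rule integral_mono)
      show "integrable circle_measure (\<lambda>z. (cmod (G z - G' z))\<^sup>2)"
        by (rule L2_circle_integrable_diff[OF L2(1,2)])
      show "integrable circle_measure
          (\<lambda>z. 2 * (cmod (F i z - G z))\<^sup>2 + 2 * (cmod (F i z - G' z))\<^sup>2)"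
        using int by simp
      show "(cmod (G z - G' z))\<^sup>2 \<le> 2 * (cmod (F i z - G z))\<^sup>2 + 2 * (cmod (F i z - G' z))\<^sup>2" for z
        using norm_diff_squared_le[of "F i z - G' z" "F i z - G z"] by simp
    qed
    also have "\<dots> = 2 * I (F i) G + 2 * I (F i) G'"
      unfolding I_def using int by simp
    finally show ?case .
  qed
  have "((\<lambda>i. 2 * I (F i) G + 2 * I (F i) G') \<longlongrightarrow> 2 * 0 + 2 * 0) A"
    by (intro tendsto_intros lim G G')
  then have "I G G' \<le> 2 * 0 + 2 * 0" using ev A by (rule tendsto_lowerbound)
  then have "I G G' = 0" by (simp add: I_def antisym)
  then have "AE z in circle_measure. (cmod (G z - G' z))\<^sup>2 = 0"
    unfolding I_def
    using integral_nonneg_eq_0_iff_AE[OF L2_circle_integrable_diff[OF L2(1,2)]] by simp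
  then show ?thesis by simp
qed

lemma L2_circle_continuous_on:
  assumes cont: "continuous_on (sphere 0 1) F"
  shows "L2_circle F"
proof -
  interpret finite_measure circle_measure by (rule finite_measure_circle_measure)
  have meas: "F \<in> borel_measurable circle_measure"
    using borel_measurable_continuous_on_restrict[OF cont]
    by (simp cong: measurable_cong_sets)
  have "compact (F ` sphere 0 1)"
    using cont by (intro compact_continuous_image) auto
  then obtain B where B: "\<And>z. cmod z = 1 \<Longrightarrow> cmod (F z) \<le> B"
    using compact_imp_bounded bounded_iff by (metis (no_types, lifting) imageI mem_sphere_0)
  have "integrable circle_measure (\<lambda>z. (cmod (F z))\<^sup>2)"
    by (rule integrable_const_bound[of _ "B\<^sup>2"])
      (use B meas in \<open>auto intro!: AE_I2 power_mono\<close>)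
  then show ?thesis using meas by (simp add: L2_circle_def)
qed

lemma L2_circle_tendsto_uniform:
  assumes A: "A \<noteq> bot" and cont: "\<forall>\<^sub>F i in A. continuous_on (sphere 0 1) (F i)"
    and unif: "uniform_limit (sphere 0 1) F G A"
  shows "L2_circle_tendsto F G A"
proof -
  interpret finite_measure circle_measure by (rule finite_measure_circle_measure)
  have L2G: "L2_circle G"
    using uniform_limit_theorem[OF cont unif A] by (rule L2_circle_continuous_on)
  have L2F: "\<forall>\<^sub>F i in A. L2_circle (F i)"
    using cont by eventually_elim (rule L2_circle_continuous_on)
  have "((\<lambda>i. LINT z|circle_measure. (cmod (F i z - G z))\<^sup>2) \<longlongrightarrow> 0) A"
  proof (rule tendstoI)
    fix e :: real assume "0 < e"
    \<comment> \<open>The circle has mass \<open>2 * pi\<close>, so a uniform error \<open>d\<close>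
      contributes at most \<open>2 * pi\<close> times its square, which is
      \<open>e / 2\<close>.\<close>
    define d where "d = sqrt (e / (4 * pi))"
    have d: "0 < d" "d\<^sup>2 = e / (4 * pi)" using \<open>0 < e\<close> by (auto simp: d_def)
    show "\<forall>\<^sub>F i in A. dist (LINT z|circle_measure. (cmod (F i z - G z))\<^sup>2) 0 < e"
      using L2F uniform_limitD[OF unif d(1)]
    proof eventually_elim
      case (elim i)
      have "(LINT z|circle_measure. (cmod (F i z - G z))\<^sup>2) \<le> (LINT z|circle_measure. d\<^sup>2)"
        using elim by (intro integral_mono L2_circle_integrable_diff L2G)
          (auto simp: dist_norm less_imp_le intro!: power_mono)
      also have "\<dots> = e / 2" using d by (simp add: measure_circle_measure)
      finally show ?case using \<open>0 < e\<close> by simp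
    qed
  qed
  then have "((\<lambda>i. sqrt (LINT z|circle_measure. (cmod (F i z - G z))\<^sup>2)) \<longlongrightarrow> sqrt 0) A"
    by (rule tendsto_real_sqrt)
  then show ?thesis using L2F L2G by (simp add: L2_circle_tendsto_def)
qed

section \<open>Existence, uniqueness and tangentiality of the boundary field\<close>

theorem corollary3:
  fixes \<Gamma> :: "(complex \<Rightarrow> complex) set"
    and \<phi> :: "complex \<Rightarrow> real"
    and c :: "(complex \<Rightarrow> complex) \<Rightarrow> complex \<Rightarrow> complex"
    and \<psi> :: "complex \<Rightarrow> complex"
  assumes "subgroup \<Gamma> PSU11" and "discrete_in_PSU11 \<Gamma>" and "cocompact_in_PSU11 \<Gamma>"
    and "smooth_on unit_disk \<phi>"
    and "\<And>z. z \<in> unit_disk \<Longrightarrow> 0 \<le> \<phi> z \<and> \<phi> z \<le> 1"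
    and "\<And>z. z \<in> unit_disk \<Longrightarrow>
      \<exists>U S. open U \<and> z \<in> U \<and> U \<subseteq> unit_disk \<and> finite S \<and> S \<subseteq> \<Gamma> \<and>
        (\<forall>\<gamma>\<in>\<Gamma> - S. \<forall>w\<in>\<gamma> ` U. \<phi> w = 0)"
    and "\<And>z. z \<in> unit_disk \<Longrightarrow> (\<Sum>\<^sub>\<infinity>\<gamma>\<in>\<Gamma>. \<phi> (\<gamma> z)) = 1"
    and "cocycle \<Gamma> c"
    and "\<And>z. z \<in> unit_disk \<Longrightarrow> \<psi> z = - (\<Sum>\<^sub>\<infinity>\<gamma>\<in>\<Gamma>. \<phi> (\<gamma> z) *\<^sub>R c \<gamma> z)"
  shows "(\<exists>\<psi>'. L2_extension \<psi> \<psi>') \<and>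
    (\<forall>\<psi>' \<psi>''. L2_extension \<psi> \<psi>' \<longrightarrow> L2_extension \<psi> \<psi>'' \<longrightarrow> L2_extension_eq \<psi>' \<psi>'') \<and>
    (\<forall>\<psi>'. L2_extension \<psi> \<psi>' \<longrightarrow> tangential \<psi>')"
proof -
  have killing: "c \<gamma> \<in> killing_fields" if "\<gamma> \<in> \<Gamma>" for \<gamma>
    using assms(8) that by (simp add: cocycle_def)
  have smooth_cont: "continuous_on unit_disk f" if "smooth_on unit_disk f"
    for f :: "complex \<Rightarrow> 'b::real_normed_vector"
    using that unfolding smooth_on_def by (metis Ck_on.simps(1))
  have cont: "continuous_on unit_disk \<psi>"
    using killing
    by (intro continuous_on_averaged_cocycle[OF assms(1) smooth_cont[OF assms(4)] assms(6) _ assms(9)]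
        smooth_cont) (auto simp: killing_fields_def)
  have fin: "finite {\<gamma> \<in> \<Gamma>. \<phi> (\<gamma> z) \<noteq> 0}" if z: "z \<in> unit_disk" for z
  proof -
    from assms(6)[OF z] obtain U S
      where US: "z \<in> U" "finite S" "\<forall>\<gamma>\<in>\<Gamma> - S. \<forall>w\<in>\<gamma> ` U. \<phi> w = 0" by blast
    then have "{\<gamma> \<in> \<Gamma>. \<phi> (\<gamma> z) \<noteq> 0} \<subseteq> S" by blast
    then show ?thesis using US(2) by (rule finite_subset)
  qed
  have equi: "\<psi> z = pullback \<gamma> \<psi> z - c \<gamma> z" if "\<gamma> \<in> \<Gamma>" "z \<in> unit_disk" for \<gamma> z
    using averaged_cocycle_equivariant[OF assms(1) fin assms(7,8,9) that] by simp
  obtain K where "\<And>\<zeta>. cmod \<zeta> = 1 \<Longrightarrow> \<exists>L. Re (cnj \<zeta> * L) = 0 \<and>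
    (\<forall>n y. 0 < y \<longrightarrow> y \<le> (1/2) ^ n \<longrightarrow>
      cmod (\<psi> (of_real (1 - y) * \<zeta>) - L) \<le> K * (real (Suc n) * (1/2) ^ n))"
    using radial_limits_of_equivariant_field[OF assms(1,3) cont killing equi] by metis
  then obtain L where L: "\<And>\<zeta>. cmod \<zeta> = 1 \<Longrightarrow> Re (cnj \<zeta> * L \<zeta>) = 0"
    and rate: "\<And>\<zeta> n y. cmod \<zeta> = 1 \<Longrightarrow> 0 < y \<Longrightarrow> y \<le> (1/2) ^ n \<Longrightarrow>
      cmod (\<psi> (of_real (1 - y) * \<zeta>) - L \<zeta>) \<le> K * (real (Suc n) * (1/2) ^ n)"
    by metis
  define Z where "Z = (\<lambda>z. if z \<in> unit_disk then \<psi> z else L z)"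
  have "uniform_limit (sphere 0 1) (\<lambda>\<epsilon> z. \<psi> (of_real (1 - \<epsilon>) * z)) Z (at_right (0::real))"
  proof (rule uniform_limitI)
    fix e :: real assume "0 < e"
    \<comment> \<open>The rate is the same at all boundary points, so one \<open>n\<close> with rate
      below \<open>e\<close> makes every \<epsilon> below \<open>(1/2) ^ n\<close> work on the whole
      circle.\<close>
    have "(\<lambda>n. K * (real (Suc n) * (1/2) ^ n)) \<longlonglongrightarrow> K * 0"
      by (intro tendsto_intros) real_asymp
    then have "\<forall>\<^sub>F n in sequentially. K * (real (Suc n) * (1/2) ^ n) < e"
      using \<open>0 < e\<close> by (intro order_tendstoD(2)) auto
    then obtain n where n: "K * (real (Suc n) * (1/2) ^ n) < e"
      by (auto simp: eventually_sequentially)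
    have "\<forall>\<^sub>F \<epsilon> in at_right (0::real). \<epsilon> \<in> {0<..<(1/2) ^ n}"
      by (rule eventually_at_right_real) simp
    then show "\<forall>\<^sub>F \<epsilon> in at_right (0::real).
        \<forall>z\<in>sphere 0 1. dist (\<psi> (of_real (1 - \<epsilon>) * z)) (Z z) < e"
    proof eventually_elim
      case (elim \<epsilon>)
      then show ?case
        using rate[of _ \<epsilon> n] n by (fastforce simp: Z_def dist_norm)
    qed
  qed
  moreover have "\<forall>\<^sub>F \<epsilon> in at_right (0::real).
      continuous_on (sphere 0 1) (\<lambda>z. \<psi> (of_real (1 - \<epsilon>) * z))"
  proof -
    have "\<forall>\<^sub>F \<epsilon> in at_right (0::real). \<epsilon> \<in> {0<..<1}"
      by (rule eventually_at_right_real) simp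
    then show ?thesis
    proof eventually_elim
      case (elim \<epsilon>)
      have "cmod (of_real (1 - \<epsilon>) * z) < 1" if "cmod z = 1" for z
        using elim that by (simp only: norm_mult norm_of_real) simp
      then show ?case
        by (intro continuous_on_compose2[OF cont] continuous_intros) auto
    qed
  qed
  ultimately have "L2_circle_tendsto (\<lambda>\<epsilon> z. \<psi> (of_real (1 - \<epsilon>) * z)) Z (at_right (0::real))"
    by (intro L2_circle_tendsto_uniform) auto
  then have Z: "L2_extension \<psi> Z"
    using cont by (simp add: L2_extension_def Z_def)
  have unique: "L2_extension_eq \<psi>' \<psi>''" if "L2_extension \<psi> \<psi>'" "L2_extension \<psi> \<psi>''" for \<psi>' \<psi>''
    using that L2_circle_tendsto_unique[of "at_right (0::real)"]
    unfolding L2_extension_def L2_extension_eq_def by (metis trivial_limit_at_right_real)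
  \<comment> \<open>Since \<open>cnj z * L z\<close> has zero real part, it is \<open>\<i>\<close>
    times its imaginary part; multiplying by \<open>z\<close> with \<open>z * cnj z = 1\<close>
    recovers \<open>L z\<close>.\<close>
  have Z_tangential: "Z z = of_real (Im (cnj z * L z)) * (\<i> * z)" if "cmod z = 1" for z
  proof -
    have "cnj z * L z = \<i> * of_real (Im (cnj z * L z))"
      using L[OF that] by (simp only: complex_eq_iff) simp
    moreover have "z * cnj z = 1" using complex_norm_square[of z] that by simp
    ultimately have "L z = of_real (Im (cnj z * L z)) * (\<i> * z)"
      by (metis mult.assoc mult.commute mult.left_commute mult_1)
    then show ?thesis using that by (simp add: Z_def)
  qed
  have "tangential \<psi>'" if "L2_extension \<psi> \<psi>'" for \<psi>'
  proof -
    \<comment> \<open>Uniqueness transfers the pointwise property of the constructed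
      \<open>Z\<close> to an arbitrary extension, up to a null set.\<close>
    have "AE z in circle_measure. \<psi>' z = Z z"
      using unique[OF that Z] by (simp add: L2_extension_eq_def)
    then have "AE z in circle_measure. \<psi>' z = of_real (Im (cnj z * L z)) * (\<i> * z)"
      by (rule AE_mp) (use Z_tangential in \<open>auto intro!: AE_I2\<close>)
    then show ?thesis
      unfolding tangential_def by (intro exI[of _ "\<lambda>z. Im (cnj z * L z)"])
  qed
  then show ?thesis using Z unique by blast
qed

end
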